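(* Let $G_1,\ldots,G_r$ be finite simple graphs, each having at least one edge, such that \[ |(V(G_1)\cup\cdots\cup V(G_{i-1}))\cap V(G_i)|\leq 1\quad\text{for all } i=2,\ldots,r, \] and let $G=G_1\cup\cdots\cup G_r$. For $i=1,\dots,r$ let $I(G_i)=\bigcap_{j=1}^{n_i}P_{ij}$ be the minimal primary decomposition of $I(G_i)$. Then \[ I(G)=\bigcap_{i=1}^r\bigcap_{j=1}^{n_i}P_{ij} \] is the minimal primary decomposition of $I(G)$. In particular, \[ \dim S/I(G)=2|E(G)|-\min\{\operatorname{height} I(G_i): i=1,\dots,r\}. \]
   Context: For a finite simple graph $G$ with edge set $E(G)=\{e_1,\dots,e_m\}$, $m\geq 1$, let $S=K[s_1,\dots,s_m,t_1,\dots,t_m]$ be the polynomial ring over a field $K$ with one pair of variables $s_i,t_i$ for each edge $e_i$. For $A\subseteq V(G)$ the cut monomial of $A$ is $u_A=\alpha_1\cdots\alpha_m$, where $\alpha_i=s_i$ if exactly one of the two vertices of $e_i$ belongs to $A$, and $\alpha_i=t_i$ otherwise. The monomial cut ideal of $G$ is $I(G)=\langle u_A: A\subseteq V(G)\rangle\subseteq S$; it is a squarefree monomial ideal, so its minimal primary decomposition is its unique irredundant representation as an intersection of monomial prime ideals (ideals generated by variables). For a subgraph $G_j$ of $G$, the ideal $I(G_j)$ is formed using only the edges of $G_j$ and the variables belonging to these edges; it and its primary components are regarded (extended) as ideals of $S$. The union $G_1\cup\cdots\cup G_r$ is the graph with vertex set $\bigcup_i V(G_i)$ and edge set $\bigcup_i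 E(G_i)$. *)

theory Defs
  imports
    "HOL-Algebra.Algebra"
    "HOL-Library.Poly_Mapping"
    "HOL-Library.Extended_Real"
begin

section \<open>Commutative algebra\<close>

text \<open>
  The polynomial ring over the field \<open>'k\<close> whose indeterminates are exactly the elements of the
  set \<open>V\<close>. The inner \<open>poly_mapping\<close> is an exponent vector, the outer one maps a monomial to its
  coefficient. The carrier is cut down to \<open>V\<close> because the Krull dimension depends on the number
  of indeterminates.
\<close>
definition mpoly_ring :: "'x set \<Rightarrow> (('x \<Rightarrow>\<^sub>0 nat) \<Rightarrow>\<^sub>0 'k::field) ring" where
  "mpoly_ring V = \<lparr>
     carrier = {p. \<forall>m\<in>Poly_Mapping.keys p. Poly_Mapping.keys m \<subseteq> V},
     monoid.mult = (\<lambda>p q. p * q), one = 1, ring.zero = 0, add = (\<lambda>p q. p + q)\<rparr>"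

definition mpoly_var :: "'x \<Rightarrow> (('x \<Rightarrow>\<^sub>0 nat) \<Rightarrow>\<^sub>0 'k::field)" where
  "mpoly_var x = Poly_Mapping.single (Poly_Mapping.single x 1) 1"

lemma mpoly_ring_cring: "cring (mpoly_ring V :: (('x \<Rightarrow>\<^sub>0 nat) \<Rightarrow>\<^sub>0 'k::field) ring)"
proof -
  let ?R = "mpoly_ring V :: (('x \<Rightarrow>\<^sub>0 nat) \<Rightarrow>\<^sub>0 'k) ring"
  have carr: "p \<in> carrier ?R \<longleftrightarrow> (\<forall>m\<in>Poly_Mapping.keys p. Poly_Mapping.keys m \<subseteq> V)" for p
    by (simp add: mpoly_ring_def)
  have ops: "p \<otimes>\<^bsub>?R\<^esub> q = p * q" "p \<oplus>\<^bsub>?R\<^esub> q = p + q" "\<one>\<^bsub>?R\<^esub> = 1" "\<zero>\<^bsub>?R\<^esub> = 0" for p q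
    by (simp_all add: mpoly_ring_def)
  have add_closed: "p + q \<in> carrier ?R" if "p \<in> carrier ?R" "q \<in> carrier ?R" for p q
    using that Poly_Mapping.keys_add[of p q] unfolding carr by blast
  have neg_closed: "- p \<in> carrier ?R" if "p \<in> carrier ?R" for p
    using that unfolding carr by (simp add: Poly_Mapping.keys.rep_eq)
  have mult_closed: "p * q \<in> carrier ?R" if p: "p \<in> carrier ?R" and q: "q \<in> carrier ?R" for p q
    unfolding carr
  proof
    fix m assume "m \<in> Poly_Mapping.keys (p * q)"
    then obtain a b where ab: "m = a + b" "a \<in> Poly_Mapping.keys p" "b \<in> Poly_Mapping.keys q"
      using Poly_Mapping.keys_mult[of p q] by blast
    have "Poly_Mapping.keys a \<union> Poly_Mapping.keys b \<subseteq> V"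
      using p q ab unfolding carr by blast
    then show "Poly_Mapping.keys m \<subseteq> V"
      using Poly_Mapping.keys_add[of a b] ab(1) by blast
  qed
  have zero_one_closed: "0 \<in> carrier ?R" "1 \<in> carrier ?R"
    unfolding carr by simp_all
  have inverse: "\<exists>q\<in>carrier ?R. q + p = 0" if "p \<in> carrier ?R" for p
    using neg_closed[OF that] by (intro bexI[of _ "- p"]) simp
  have "abelian_group ?R"
    by (rule abelian_groupI; unfold ops)
       (rule add_closed zero_one_closed inverse add.assoc add.commute add_0_left; assumption)+
  moreover have "comm_monoid ?R"
    by (rule comm_monoidI; unfold ops)
       (rule mult_closed zero_one_closed mult.assoc mult.commute mult_1_left; assumption)+
  ultimately show ?thesis
    by (rule cringI) (unfold ops, rule distrib_right)
qed

definition primary_ideal :: "('a, 'm) ring_scheme \<Rightarrow> 'a set \<Rightarrow> bool" where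
  "primary_ideal R Q \<longleftrightarrow> ideal Q R \<and> Q \<noteq> carrier R \<and>
     (\<forall>a\<in>carrier R. \<forall>b\<in>carrier R. a \<otimes>\<^bsub>R\<^esub> b \<in> Q \<longrightarrow> a \<in> Q \<or> (\<exists>n::nat. b [^]\<^bsub>R\<^esub> n \<in> Q))"

definition ideal_radical :: "('a, 'm) ring_scheme \<Rightarrow> 'a set \<Rightarrow> 'a set" where
  "ideal_radical R I = {a \<in> carrier R. \<exists>n::nat. a [^]\<^bsub>R\<^esub> n \<in> I}"

text \<open>
  A minimal primary decomposition of \<open>I\<close> is an indexed family, so irredundancy also excludes
  repeated components. Intersecting with the carrier fixes the value of the empty intersection.
\<close>
definition minimal_primary_decomposition ::
    "('a, 'm) ring_scheme \<Rightarrow> 'a set \<Rightarrow> 'j set \<Rightarrow> ('j \<Rightarrow> 'a set) \<Rightarrow> bool" where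
  "minimal_primary_decomposition R I J Q \<longleftrightarrow>
     finite J \<and> (\<forall>j\<in>J. primary_ideal R (Q j)) \<and>
     I = carrier R \<inter> (\<Inter>j\<in>J. Q j) \<and>
     (\<forall>j\<in>J. I \<noteq> carrier R \<inter> (\<Inter>k\<in>J - {j}. Q k)) \<and>
     inj_on (\<lambda>j. ideal_radical R (Q j)) J"

definition prime_chain :: "('a, 'm) ring_scheme \<Rightarrow> nat \<Rightarrow> (nat \<Rightarrow> 'a set) \<Rightarrow> bool" where
  "prime_chain R n P \<longleftrightarrow> (\<forall>i\<le>n. primeideal (P i) R) \<and> (\<forall>i<n. P i \<subset> P (Suc i))"

text \<open>
  Dimension and height take values in \<open>ereal\<close>, where subtraction does not truncate. The zero ring
  has dimension \<open>-\<infinity>\<close> and the unit ideal has height \<open>\<infinity>\<close>.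
\<close>
definition krull_dim :: "('a, 'm) ring_scheme \<Rightarrow> ereal" where
  "krull_dim R = (SUP n\<in>{n. \<exists>P. prime_chain R n P}. ereal (real n))"

definition prime_height :: "('a, 'm) ring_scheme \<Rightarrow> 'a set \<Rightarrow> ereal" where
  "prime_height R Q = (SUP n\<in>{n. \<exists>P. prime_chain R n P \<and> P n = Q}. ereal (real n))"

definition ideal_height :: "('a, 'm) ring_scheme \<Rightarrow> 'a set \<Rightarrow> ereal" where
  "ideal_height R I = (INF Q\<in>{Q. primeideal Q R \<and> I \<subseteq> Q}. prime_height R Q)"

section \<open>Graphs and monomial cut ideals\<close>

record 'v graph =
  verts :: "'v set"
  edges :: "'v set set"

definition finite_simple_graph :: "'v graph \<Rightarrow> bool" where
  "finite_simple_graph G \<longleftrightarrow>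
     finite (verts G) \<and> (\<forall>e\<in>edges G. e \<subseteq> verts G \<and> card e = 2)"

definition graph_union :: "('i \<Rightarrow> 'v graph) \<Rightarrow> 'i set \<Rightarrow> 'v graph" where
  "graph_union G I = \<lparr>verts = (\<Union>i\<in>I. verts (G i)), edges = (\<Union>i\<in>I. edges (G i))\<rparr>"

text \<open>The indeterminates \<open>s\<close> and \<open>t\<close> attached to an edge.\<close>
datatype 'e cut_var = VarS 'e | VarT 'e

text \<open>
  Indexing the indeterminates by the edges themselves makes the ring of a subgraph a subring of
  the ring of the whole graph.
\<close>
definition cut_ring :: "'v graph \<Rightarrow> (('v set cut_var \<Rightarrow>\<^sub>0 nat) \<Rightarrow>\<^sub>0 'k::field) ring" where
  "cut_ring G = mpoly_ring (VarS ` edges G \<union> VarT ` edges G)"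

definition cut_monomial :: "'v graph \<Rightarrow> 'v set \<Rightarrow> (('v set cut_var \<Rightarrow>\<^sub>0 nat) \<Rightarrow>\<^sub>0 'k::field)" where
  "cut_monomial G A =
     (\<Prod>e\<in>edges G. mpoly_var (if card (e \<inter> A) = 1 then VarS e else VarT e))"

definition cut_ideal :: "'v graph \<Rightarrow> (('v set cut_var \<Rightarrow>\<^sub>0 nat) \<Rightarrow>\<^sub>0 'k::field) set" where
  "cut_ideal G = Idl\<^bsub>cut_ring G\<^esub> {cut_monomial G A | A. A \<subseteq> verts G}"

end

theory Submission
  imports Defs
begin

text \<open>
  Write \<open>F\<close> for the family of supports of the cut monomials of a graph. A monomial lies in the cut
  ideal iff its support contains a member of \<open>F\<close>, and dually a prime generated by variables \<open>W\<close>
  contains the cut ideal iff \<open>W\<close> meets every member of \<open>F\<close>. So everything is read off from the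
  transversals of \<open>F\<close>.

  The graphs are glued along single vertices, and a vertex set cuts the same edges as its
  complement. Hence arbitrary cuts of the \<open>G i\<close> can be realised by one cut of the union
  (\<open>glue_cuts\<close>), and the supports for \<open>H\<close> are the unions of one support from each \<open>G i\<close>
  (\<open>cut_family_graph_union_iff\<close>). It follows that the cut ideal of \<open>H\<close> is the intersection of the
  extended cut ideals of the \<open>G i\<close>, and that a set is a transversal for \<open>H\<close> iff it is one for some
  \<open>G i\<close> (\<open>transversals_graph_union\<close>).

  For the decomposition, a squarefree monomial ideal is the intersection of the incomparable primes
  generated by its minimal transversals (\<open>monomial_ideal_eq_Inter\<close>), and in every commutative ring the
  components of a minimal primary decomposition of such an intersection are among these primes
  (\<open>minimal_primary_decomposition_of_primes\<close>). So all \<open>P i j\<close> are generated by variables. The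
  variable sets are incomparable for equal \<open>i\<close>, and disjoint and nonempty for different \<open>i\<close> because
  the graphs share no edge. Incomparable variable primes are irredundant
  (\<open>minimal_primary_decomposition_var_ideals\<close>).

  For the dimension, the height of a squarefree monomial ideal is the least size of a transversal
  (\<open>ideal_height_monomial_ideal\<close>), and the dimension of the quotient is the number of variables
  minus this size (\<open>krull_dim_quot_monomial_ideal\<close>). The lower bounds on chain lengths come from
  primes generated by variables. All upper bounds follow from a single one: a chain of primes in a
  polynomial ring over a field has length at most the number of variables
  (\<open>mpoly_prime_chain_length\<close>). A longer chain would provide more elements than there are
  variables, one from each step. These are algebraically dependent by counting dimensions
  (\<open>algebraically_dependent\<close>), whereas elements chosen along a chain of primes satisfy no polynomial
  relation modulo the smallest prime (\<open>prime_chain_no_relation\<close>).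
\<close>

section \<open>Squarefree monomial ideals and their variable primes\<close>

lemma mpoly_carrier_iff:
  "p \<in> carrier (mpoly_ring V) \<longleftrightarrow> (\<forall>m\<in>Poly_Mapping.keys p. Poly_Mapping.keys m \<subseteq> V)"
  by (simp add: mpoly_ring_def)

lemma mpoly_ring_ops [simp]:
  "p \<otimes>\<^bsub>mpoly_ring V\<^esub> q = p * q" "p \<oplus>\<^bsub>mpoly_ring V\<^esub> q = p + q"
  "\<one>\<^bsub>mpoly_ring V\<^esub> = 1" "\<zero>\<^bsub>mpoly_ring V\<^esub> = 0"
  by (simp_all add: mpoly_ring_def)

lemma keys_add_nat:
  "Poly_Mapping.keys (a + b :: 'x \<Rightarrow>\<^sub>0 nat) = Poly_Mapping.keys a \<union> Poly_Mapping.keys b"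
  by (auto simp: in_keys_iff lookup_add)

lemma mpoly_idealI:
  assumes sub: "I \<subseteq> carrier (mpoly_ring V :: (('x \<Rightarrow>\<^sub>0 nat) \<Rightarrow>\<^sub>0 'k::field) ring)"
    and zero: "0 \<in> I"
    and add: "\<And>a b. a \<in> I \<Longrightarrow> b \<in> I \<Longrightarrow> a + b \<in> I"
    and mult: "\<And>a x. a \<in> I \<Longrightarrow> x \<in> carrier (mpoly_ring V) \<Longrightarrow> x * a \<in> I"
  shows "ideal I (mpoly_ring V)"
proof -
  interpret R: cring "mpoly_ring V :: (('x \<Rightarrow>\<^sub>0 nat) \<Rightarrow>\<^sub>0 'k) ring" by (rule mpoly_ring_cring)
  have minus: "\<ominus>\<^bsub>mpoly_ring V\<^esub> a \<in> I" if "a \<in> I" for a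
  proof -
    have "a \<in> carrier (mpoly_ring V)" using that sub by blast
    then have "\<ominus>\<^bsub>mpoly_ring V\<^esub> a = (\<ominus>\<^bsub>mpoly_ring V\<^esub> \<one>\<^bsub>mpoly_ring V\<^esub>) \<otimes>\<^bsub>mpoly_ring V\<^esub> a"
      using R.l_minus R.l_one R.one_closed by metis
    also have "\<dots> \<in> I"
      using mult[OF that] R.a_inv_closed[OF R.one_closed] by simp
    finally show ?thesis .
  qed
  show ?thesis
  proof (rule idealI[OF R.ring_axioms])
    show "subgroup I (add_monoid (mpoly_ring V))"
      by (rule R.add.subgroupI)
         (use sub zero add minus in \<open>auto simp: a_inv_def\<close>)
    show "x \<otimes>\<^bsub>mpoly_ring V\<^esub> a \<in> I" if "a \<in> I" "x \<in> carrier (mpoly_ring V)" for a x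
      using mult[OF that] by simp
    show "a \<otimes>\<^bsub>mpoly_ring V\<^esub> x \<in> I" if "a \<in> I" "x \<in> carrier (mpoly_ring V)" for a x
      using mult[OF that] by (simp add: mult.commute)
  qed
qed

lemma mpoly_idealD:
  assumes "ideal I (mpoly_ring V :: (('x \<Rightarrow>\<^sub>0 nat) \<Rightarrow>\<^sub>0 'k::field) ring)"
  shows "I \<subseteq> carrier (mpoly_ring V)" "0 \<in> I"
    "\<And>a b. a \<in> I \<Longrightarrow> b \<in> I \<Longrightarrow> a + b \<in> I"
    "\<And>a x. a \<in> I \<Longrightarrow> x \<in> carrier (mpoly_ring V) \<Longrightarrow> x * a \<in> I"
proof -
  interpret ideal I "mpoly_ring V" by fact
  show "I \<subseteq> carrier (mpoly_ring V)" by (rule a_subset)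
  show "0 \<in> I" using additive_subgroup.zero_closed[OF additive_subgroup_axioms] by simp
  show "\<And>a b. a \<in> I \<Longrightarrow> b \<in> I \<Longrightarrow> a + b \<in> I"
    using additive_subgroup.a_closed[OF additive_subgroup_axioms] by simp
  show "\<And>a x. a \<in> I \<Longrightarrow> x \<in> carrier (mpoly_ring V) \<Longrightarrow> x * a \<in> I" using I_l_closed by simp
qed

lemma mpoly_ideal_sum:
  assumes "ideal I (mpoly_ring V)" "\<And>a. a \<in> A \<Longrightarrow> f a \<in> I"
  shows "sum f A \<in> I"
  using assms(2) mpoly_idealD(2,3)[OF assms(1)] by (induction A rule: infinite_finite_induct) auto

lemma mpoly_primeD:
  assumes "primeideal I (mpoly_ring V :: (('x \<Rightarrow>\<^sub>0 nat) \<Rightarrow>\<^sub>0 'k::field) ring)"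
  shows "ideal I (mpoly_ring V)" "1 \<notin> I"
    "\<And>a b. a \<in> carrier (mpoly_ring V) \<Longrightarrow> b \<in> carrier (mpoly_ring V) \<Longrightarrow> a * b \<in> I \<Longrightarrow> a \<in> I \<or> b \<in> I"
proof -
  interpret primeideal I "mpoly_ring V" by fact
  show "ideal I (mpoly_ring V)" by (rule is_ideal)
  show "1 \<notin> I" using I_notcarr one_imp_carrier by auto
  show "\<And>a b. a \<in> carrier (mpoly_ring V) \<Longrightarrow> b \<in> carrier (mpoly_ring V) \<Longrightarrow> a * b \<in> I \<Longrightarrow> a \<in> I \<or> b \<in> I"
    using I_prime by simp
qed

text \<open>
  The squarefree monomial ideal with one generator, the product of the variables in \<open>f\<close>, for each
  \<open>f\<close> in \<open>F\<close>. Membership depends only on the supports of the monomials of a polynomial.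
\<close>
definition monomial_ideal :: "'x set \<Rightarrow> 'x set set \<Rightarrow> (('x \<Rightarrow>\<^sub>0 nat) \<Rightarrow>\<^sub>0 'k::field) set" where
  "monomial_ideal V F = {p \<in> carrier (mpoly_ring V).
     \<forall>m\<in>Poly_Mapping.keys p. \<exists>f\<in>F. f \<subseteq> Poly_Mapping.keys m}"

text \<open>The monomial prime ideals: this one is generated by the variables in \<open>W\<close>.\<close>
definition var_ideal :: "'x set \<Rightarrow> 'x set \<Rightarrow> (('x \<Rightarrow>\<^sub>0 nat) \<Rightarrow>\<^sub>0 'k::field) set" where
  "var_ideal V W = {p \<in> carrier (mpoly_ring V).
     \<forall>m\<in>Poly_Mapping.keys p. Poly_Mapping.keys m \<inter> W \<noteq> {}}"

lemma var_ideal_eq_monomial_ideal: "var_ideal V W = monomial_ideal V ((\<lambda>x. {x}) ` W)"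
  unfolding var_ideal_def monomial_ideal_def by blast

lemma monomial_ideal_ideal:
  "ideal (monomial_ideal V F :: (('x \<Rightarrow>\<^sub>0 nat) \<Rightarrow>\<^sub>0 'k::field) set) (mpoly_ring V)"
proof (rule mpoly_idealI)
  interpret R: cring "mpoly_ring V :: (('x \<Rightarrow>\<^sub>0 nat) \<Rightarrow>\<^sub>0 'k) ring" by (rule mpoly_ring_cring)
  show "monomial_ideal V F \<subseteq> carrier (mpoly_ring V)" by (auto simp: monomial_ideal_def)
  show "(0 :: ('x \<Rightarrow>\<^sub>0 nat) \<Rightarrow>\<^sub>0 'k) \<in> monomial_ideal V F" using R.zero_closed by (simp add: monomial_ideal_def)
  fix a b :: "('x \<Rightarrow>\<^sub>0 nat) \<Rightarrow>\<^sub>0 'k"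
  assume a: "a \<in> monomial_ideal V F"
  show "a + b \<in> monomial_ideal V F" if b: "b \<in> monomial_ideal V F"
    using a b R.a_closed[of a b] Poly_Mapping.keys_add[of a b]
    unfolding monomial_ideal_def by auto
  show "b * a \<in> monomial_ideal V F" if b: "b \<in> carrier (mpoly_ring V)"
  proof -
    have "\<exists>f\<in>F. f \<subseteq> Poly_Mapping.keys m" if m: "m \<in> Poly_Mapping.keys (b * a)" for m
    proof -
      obtain u v where "m = u + v" "v \<in> Poly_Mapping.keys a"
        using Poly_Mapping.keys_mult[of b a] m by blast
      moreover from this(2) obtain f where "f \<in> F" "f \<subseteq> Poly_Mapping.keys v"
        using a unfolding monomial_ideal_def by blast
      ultimately show ?thesis by (auto simp: keys_add_nat)
    qed
    moreover have "b * a \<in> carrier (mpoly_ring V)"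
      using a b R.m_closed[of b a] unfolding monomial_ideal_def by simp
    ultimately show ?thesis unfolding monomial_ideal_def by blast
  qed
qed

lemma var_ideal_ideal: "ideal (var_ideal V W) (mpoly_ring V)"
  unfolding var_ideal_eq_monomial_ideal by (rule monomial_ideal_ideal)

lemma prod_mpoly_var:
  "(\<Prod>x\<in>f. mpoly_var x) = Poly_Mapping.single (\<Sum>x\<in>f. Poly_Mapping.single x 1) (1::'k::field)"
  by (induction f rule: infinite_finite_induct) (simp_all add: mpoly_var_def mult_single)

lemma lookup_sum_single:
  "finite f \<Longrightarrow> Poly_Mapping.lookup (\<Sum>x\<in>f. Poly_Mapping.single x (1::nat)) y = (if y \<in> f then 1 else 0)"
  by (simp add: lookup_sum lookup_single when_def)

lemma keys_sum_single:
  "finite f \<Longrightarrow> Poly_Mapping.keys (\<Sum>x\<in>f. Poly_Mapping.single x (1::nat)) = f"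
  unfolding set_eq_iff in_keys_iff by (simp only: lookup_sum_single) simp

lemma prod_var_in_carrier:
  assumes "finite f" "f \<subseteq> V"
  shows "(\<Prod>x\<in>f. mpoly_var x) \<in> carrier (mpoly_ring V)"
  unfolding mpoly_carrier_iff prod_mpoly_var using assms(2) keys_sum_single[OF assms(1)] by auto

lemma prod_var_in_monomial_ideal:
  assumes "finite f" "f \<subseteq> V"
  shows "(\<Prod>x\<in>f. mpoly_var x :: ('x \<Rightarrow>\<^sub>0 nat) \<Rightarrow>\<^sub>0 'k::field) \<in> monomial_ideal V F \<longleftrightarrow> (\<exists>g\<in>F. g \<subseteq> f)"
proof -
  have "Poly_Mapping.keys (\<Prod>x\<in>f. mpoly_var x :: ('x \<Rightarrow>\<^sub>0 nat) \<Rightarrow>\<^sub>0 'k) = {\<Sum>x\<in>f. Poly_Mapping.single x 1}"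
    unfolding prod_mpoly_var by simp
  then show ?thesis
    using keys_sum_single[OF assms(1)]
    by (simp add: monomial_ideal_def prod_var_in_carrier[OF assms] del: One_nat_def)
qed

lemma prod_var_in_var_ideal:
  assumes "finite f" "f \<subseteq> V"
  shows "(\<Prod>x\<in>f. mpoly_var x) \<in> var_ideal V W \<longleftrightarrow> f \<inter> W \<noteq> {}"
  unfolding var_ideal_eq_monomial_ideal prod_var_in_monomial_ideal[OF assms] by blast

lemma mpoly_eq_sum_monomials:
  "p = (\<Sum>m\<in>Poly_Mapping.keys p. Poly_Mapping.single m (Poly_Mapping.lookup p m))"
  by (rule poly_mapping_eqI) (auto simp: lookup_sum lookup_single when_def in_keys_iff)

text \<open>
  A polynomial is the sum of its terms, and a monomial whose support contains \<open>f\<close> is a multiple of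
  the product of the variables in \<open>f\<close>.
\<close>
lemma genideal_prod_var:
  assumes F: "\<And>f. f \<in> F \<Longrightarrow> finite f \<and> f \<subseteq> V"
  shows "Idl\<^bsub>mpoly_ring V\<^esub> ((\<lambda>f. \<Prod>x\<in>f. mpoly_var x) ` F) = 
    (monomial_ideal V F :: (('x \<Rightarrow>\<^sub>0 nat) \<Rightarrow>\<^sub>0 'k::field) set)"
proof
  interpret R: cring "mpoly_ring V :: (('x \<Rightarrow>\<^sub>0 nat) \<Rightarrow>\<^sub>0 'k) ring" by (rule mpoly_ring_cring)
  let ?g = "\<lambda>f. (\<Prod>x\<in>f. mpoly_var x) :: ('x \<Rightarrow>\<^sub>0 nat) \<Rightarrow>\<^sub>0 'k"
  have gen: "?g f \<in> monomial_ideal V F" if "f \<in> F" for f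
    using F[OF that] that by (auto simp: prod_var_in_monomial_ideal)
  then show "Idl\<^bsub>mpoly_ring V\<^esub> (?g ` F) \<subseteq> monomial_ideal V F"
    by (intro R.genideal_minimal monomial_ideal_ideal) blast
  have gc: "?g ` F \<subseteq> carrier (mpoly_ring V)" using F prod_var_in_carrier by blast
  note I = R.genideal_ideal[OF gc]
  show "monomial_ideal V F \<subseteq> Idl\<^bsub>mpoly_ring V\<^esub> (?g ` F)"
  proof
    fix p :: "('x \<Rightarrow>\<^sub>0 nat) \<Rightarrow>\<^sub>0 'k" assume p: "p \<in> monomial_ideal V F"
    have "Poly_Mapping.single m (Poly_Mapping.lookup p m) \<in> Idl\<^bsub>mpoly_ring V\<^esub> (?g ` F)"
      if m: "m \<in> Poly_Mapping.keys p" for m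
    proof -
      obtain f where f: "f \<in> F" "f \<subseteq> Poly_Mapping.keys m"
        using p m unfolding monomial_ideal_def by blast
      have mV: "Poly_Mapping.keys m \<subseteq> V"
        using p m unfolding monomial_ideal_def mpoly_carrier_iff by blast
      let ?e = "\<Sum>x\<in>f. Poly_Mapping.single x (1::nat)"
      have m_eq: "(m - ?e) + ?e = m"
      proof (rule poly_mapping_eqI)
        fix y
        have "Poly_Mapping.lookup m y \<noteq> 0" if "y \<in> f" using that f(2) by (auto simp: in_keys_iff)
        moreover have "Poly_Mapping.lookup ?e y = (if y \<in> f then 1 else 0)"
          using F[OF f(1)] by (intro lookup_sum_single) blast
        ultimately show "Poly_Mapping.lookup ((m - ?e) + ?e) y = Poly_Mapping.lookup m y"
          by (simp only: lookup_add lookup_minus) (auto split: if_splits)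
      qed
      have "Poly_Mapping.keys (m - ?e) \<subseteq> Poly_Mapping.keys m"
        by (auto simp: in_keys_iff lookup_minus)
      then have "Poly_Mapping.single (m - ?e) (Poly_Mapping.lookup p m) \<in> carrier (mpoly_ring V)"
        using mV by (auto simp: mpoly_carrier_iff)
      then have "Poly_Mapping.single (m - ?e) (Poly_Mapping.lookup p m) * ?g f \<in> Idl\<^bsub>mpoly_ring V\<^esub> (?g ` F)"
        using R.genideal_self[OF gc] f(1) by (intro mpoly_idealD(4)[OF I]) auto
      then show ?thesis unfolding prod_mpoly_var mult_single m_eq mult_1_right .
    qed
    then have "(\<Sum>m\<in>Poly_Mapping.keys p. Poly_Mapping.single m (Poly_Mapping.lookup p m))
        \<in> Idl\<^bsub>mpoly_ring V\<^esub> (?g ` F)"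
      by (rule mpoly_ideal_sum[OF I])
    then show "p \<in> Idl\<^bsub>mpoly_ring V\<^esub> (?g ` F)"
      using mpoly_eq_sum_monomials[of p] by simp
  qed
qed

text \<open>Both ideals have the same generators, so extension to more variables keeps the form of the ideal.\<close>
lemma genideal_monomial_ideal:
  assumes F: "\<And>f. f \<in> F \<Longrightarrow> finite f \<and> f \<subseteq> U" and "U \<subseteq> V"
  shows "Idl\<^bsub>mpoly_ring V\<^esub> (monomial_ideal U F) = 
    (monomial_ideal V F :: (('x \<Rightarrow>\<^sub>0 nat) \<Rightarrow>\<^sub>0 'k::field) set)"
proof
  interpret R: cring "mpoly_ring V :: (('x \<Rightarrow>\<^sub>0 nat) \<Rightarrow>\<^sub>0 'k) ring" by (rule mpoly_ring_cring)
  have sub: "(monomial_ideal U F :: (('x \<Rightarrow>\<^sub>0 nat) \<Rightarrow>\<^sub>0 'k) set) \<subseteq> monomial_ideal V F"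
    using \<open>U \<subseteq> V\<close> by (auto simp: monomial_ideal_def mpoly_carrier_iff)
  then show "Idl\<^bsub>mpoly_ring V\<^esub> (monomial_ideal U F) \<subseteq> (monomial_ideal V F :: (('x \<Rightarrow>\<^sub>0 nat) \<Rightarrow>\<^sub>0 'k) set)"
    by (rule R.genideal_minimal[OF monomial_ideal_ideal])
  have "(\<lambda>f. \<Prod>x\<in>f. mpoly_var x) ` F \<subseteq> (monomial_ideal U F :: (('x \<Rightarrow>\<^sub>0 nat) \<Rightarrow>\<^sub>0 'k) set)"
    using F by (auto simp: prod_var_in_monomial_ideal)
  moreover have "(monomial_ideal U F :: (('x \<Rightarrow>\<^sub>0 nat) \<Rightarrow>\<^sub>0 'k) set) \<subseteq> carrier (mpoly_ring V)"
    using sub mpoly_idealD(1)[OF monomial_ideal_ideal] by blast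
  ultimately have "Idl\<^bsub>mpoly_ring V\<^esub> ((\<lambda>f. \<Prod>x\<in>f. mpoly_var x) ` F) \<subseteq> 
      Idl\<^bsub>mpoly_ring V\<^esub> (monomial_ideal U F :: (('x \<Rightarrow>\<^sub>0 nat) \<Rightarrow>\<^sub>0 'k) set)"
    by (intro R.genideal_minimal R.genideal_ideal) (use R.genideal_self in blast)+
  then show "(monomial_ideal V F :: (('x \<Rightarrow>\<^sub>0 nat) \<Rightarrow>\<^sub>0 'k) set) \<subseteq> Idl\<^bsub>mpoly_ring V\<^esub> (monomial_ideal U F)"
    using genideal_prod_var[of F V] F \<open>U \<subseteq> V\<close> by blast
qed

lemma genideal_var_ideal:
  assumes "W \<subseteq> U" "U \<subseteq> V"
  shows "Idl\<^bsub>mpoly_ring V\<^esub> (var_ideal U W) = var_ideal V W"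
  unfolding var_ideal_eq_monomial_ideal by (rule genideal_monomial_ideal) (use assms in auto)

text \<open>
  Comparing one exponent after the other, the lexicographically largest elements \<open>a\<close> of \<open>A\<close> and
  \<open>b\<close> of \<open>B\<close> have a sum that no other pair attains.
\<close>
lemma unique_sum_of_exponents:
  fixes A B :: "('x \<Rightarrow>\<^sub>0 nat) set"
  assumes "finite V" "finite A" "A \<noteq> {}" "finite B" "B \<noteq> {}"
  shows "\<exists>a\<in>A. \<exists>b\<in>B. \<forall>a'\<in>A. \<forall>b'\<in>B.
    (\<forall>x\<in>V. Poly_Mapping.lookup (a' + b') x = Poly_Mapping.lookup (a + b) x) \<longrightarrow>
    (\<forall>x\<in>V. Poly_Mapping.lookup a' x = Poly_Mapping.lookup a x \<and>
            Poly_Mapping.lookup b' x = Poly_Mapping.lookup b x)"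
  using assms
proof (induction V arbitrary: A B rule: finite_induct)
  case empty
  then show ?case by auto
next
  case (insert z V)
  let ?e = "\<lambda>m. Poly_Mapping.lookup m z"
  define A1 where "A1 = {a\<in>A. ?e a = Max (?e ` A)}"
  define B1 where "B1 = {b\<in>B. ?e b = Max (?e ` B)}"
  have "Max (?e ` A) \<in> ?e ` A" "Max (?e ` B) \<in> ?e ` B"
    using insert.prems by (auto intro!: Max_in)
  then have "A1 \<noteq> {}" "B1 \<noteq> {}" by (auto simp: A1_def B1_def)
  moreover have "finite A1" "finite B1" using insert.prems by (auto simp: A1_def B1_def)
  ultimately obtain a b where ab: "a \<in> A1" "b \<in> B1"
    "\<And>a' b'. a' \<in> A1 \<Longrightarrow> b' \<in> B1 \<Longrightarrow>
    (\<forall>x\<in>V. Poly_Mapping.lookup (a' + b') x = Poly_Mapping.lookup (a + b) x) \<Longrightarrow>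
    (\<forall>x\<in>V. Poly_Mapping.lookup a' x = Poly_Mapping.lookup a x \<and>
            Poly_Mapping.lookup b' x = Poly_Mapping.lookup b x)"
    using insert.IH[of A1 B1] by blast
  have "\<forall>x\<in>insert z V. Poly_Mapping.lookup a' x = Poly_Mapping.lookup a x \<and>
            Poly_Mapping.lookup b' x = Poly_Mapping.lookup b x"
    if a': "a' \<in> A" and b': "b' \<in> B" and
      eq: "\<forall>x\<in>insert z V. Poly_Mapping.lookup (a' + b') x = Poly_Mapping.lookup (a + b) x" for a' b'
  proof -
    have "?e a' \<le> Max (?e ` A)" "?e b' \<le> Max (?e ` B)"
      using a' b' insert.prems by auto
    moreover have "?e a' + ?e b' = Max (?e ` A) + Max (?e ` B)"
      using eq ab(1,2) by (simp add: lookup_add A1_def B1_def)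
    ultimately have z: "?e a' = Max (?e ` A)" "?e b' = Max (?e ` B)" by linarith+
    then have "a' \<in> A1" "b' \<in> B1" using a' b' by (auto simp: A1_def B1_def)
    then have "\<forall>x\<in>V. Poly_Mapping.lookup a' x = Poly_Mapping.lookup a x \<and>
            Poly_Mapping.lookup b' x = Poly_Mapping.lookup b x"
      using ab(3) eq by blast
    then show ?thesis using z ab(1,2) by (simp add: A1_def B1_def)
  qed
  then show ?case using ab(1,2) unfolding A1_def B1_def by blast
qed

lemma lookup_mult_unique:
  assumes "\<And>a' b'. a' \<in> Poly_Mapping.keys p \<Longrightarrow> b' \<in> Poly_Mapping.keys q \<Longrightarrow> a' + b' = a + b
    \<Longrightarrow> a' = a \<and> b' = b"
    and a: "a \<in> Poly_Mapping.keys p" and b: "b \<in> Poly_Mapping.keys q"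
  shows "Poly_Mapping.lookup (p * q) (a + b) = Poly_Mapping.lookup p a * Poly_Mapping.lookup q b"
proof -
  have "p * q = (\<Sum>a'\<in>Poly_Mapping.keys p. \<Sum>b'\<in>Poly_Mapping.keys q.
      Poly_Mapping.single (a' + b') (Poly_Mapping.lookup p a' * Poly_Mapping.lookup q b'))"
    by (subst mpoly_eq_sum_monomials[of p], subst mpoly_eq_sum_monomials[of q])
       (simp add: sum_product mult_single)
  then have "Poly_Mapping.lookup (p * q) (a + b) =
      (\<Sum>a'\<in>Poly_Mapping.keys p. \<Sum>b'\<in>Poly_Mapping.keys q.
         (Poly_Mapping.lookup p a' * Poly_Mapping.lookup q b' when a' + b' = a + b))"
    by (simp add: lookup_sum lookup_single)
  also have "\<dots> = (\<Sum>a'\<in>Poly_Mapping.keys p. \<Sum>b'\<in>Poly_Mapping.keys q.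
         (if b' = b then if a' = a then Poly_Mapping.lookup p a * Poly_Mapping.lookup q b else 0 else 0))"
    using assms(1) by (intro sum.cong refl) (auto simp: when_def)
  also have "\<dots> = Poly_Mapping.lookup p a * Poly_Mapping.lookup q b"
    using a b by simp
  finally show ?thesis .
qed

text \<open>
  If neither factor lies in the ideal, both have monomials avoiding \<open>W\<close>. Among those monomials some
  pair has a product which arises only once, and its coefficient in the product does not vanish.
\<close>
lemma var_ideal_prime:
  "primeideal (var_ideal V W :: (('x \<Rightarrow>\<^sub>0 nat) \<Rightarrow>\<^sub>0 'k::field) set) (mpoly_ring V)"
proof (rule primeidealI[OF var_ideal_ideal mpoly_ring_cring])
  interpret R: cring "mpoly_ring V :: (('x \<Rightarrow>\<^sub>0 nat) \<Rightarrow>\<^sub>0 'k) ring" by (rule mpoly_ring_cring)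
  have "(1 :: ('x \<Rightarrow>\<^sub>0 nat) \<Rightarrow>\<^sub>0 'k) \<notin> var_ideal V W" by (simp add: var_ideal_def)
  then show "carrier (mpoly_ring V) \<noteq> (var_ideal V W :: (('x \<Rightarrow>\<^sub>0 nat) \<Rightarrow>\<^sub>0 'k) set)"
    using R.one_closed by auto
  fix p q :: "('x \<Rightarrow>\<^sub>0 nat) \<Rightarrow>\<^sub>0 'k"
  assume carr: "p \<in> carrier (mpoly_ring V)" "q \<in> carrier (mpoly_ring V)"
    and pq: "p \<otimes>\<^bsub>mpoly_ring V\<^esub> q \<in> var_ideal V W"
  show "p \<in> var_ideal V W \<or> q \<in> var_ideal V W"
  proof (rule ccontr)
    assume neg: "\<not> ?thesis"
    define A where "A = {m\<in>Poly_Mapping.keys p. Poly_Mapping.keys m \<inter> W = {}}"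
    define B where "B = {m\<in>Poly_Mapping.keys q. Poly_Mapping.keys m \<inter> W = {}}"
    define U where "U = (\<Union>m\<in>A \<union> B. Poly_Mapping.keys m)"
    have fin: "finite A" "finite B" "finite U" by (simp_all add: A_def B_def U_def)
    have ne: "A \<noteq> {}" "B \<noteq> {}" using neg carr by (auto simp: var_ideal_def A_def B_def)
    obtain a b where ab: "a \<in> A" "b \<in> B" and
      uniq: "\<And>a' b'. a' \<in> A \<Longrightarrow> b' \<in> B \<Longrightarrow>
    (\<forall>x\<in>U. Poly_Mapping.lookup (a' + b') x = Poly_Mapping.lookup (a + b) x) \<Longrightarrow>
    (\<forall>x\<in>U. Poly_Mapping.lookup a' x = Poly_Mapping.lookup a x \<and>
            Poly_Mapping.lookup b' x = Poly_Mapping.lookup b x)"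
      using unique_sum_of_exponents[OF fin(3,1) ne(1) fin(2) ne(2)] by blast
    have eqI: "m = n" if "m \<in> A \<union> B" "n \<in> A \<union> B"
      "\<forall>x\<in>U. Poly_Mapping.lookup m x = Poly_Mapping.lookup n x" for m n
    proof (rule poly_mapping_eqI)
      fix x
      show "Poly_Mapping.lookup m x = Poly_Mapping.lookup n x"
      proof (cases "x \<in> U")
        case False
        then have "x \<notin> Poly_Mapping.keys m" "x \<notin> Poly_Mapping.keys n"
          using that(1,2) unfolding U_def by blast+
        then show ?thesis by (simp add: in_keys_iff)
      qed (use that(3) in blast)
    qed
    have "Poly_Mapping.lookup (p * q) (a + b) = Poly_Mapping.lookup p a * Poly_Mapping.lookup q b"
    proof (rule lookup_mult_unique)
      fix a' b' assume *: "a' \<in> Poly_Mapping.keys p" "b' \<in> Poly_Mapping.keys q" "a' + b' = a + b"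
      have "Poly_Mapping.keys a' \<union> Poly_Mapping.keys b' = Poly_Mapping.keys a \<union> Poly_Mapping.keys b"
        using *(3) by (metis keys_add_nat)
      then have "a' \<in> A" "b' \<in> B" using *(1,2) ab unfolding A_def B_def by auto
      then show "a' = a \<and> b' = b" using uniq[of a' b'] ab *(3) by (auto intro!: eqI)
    qed (use ab in \<open>auto simp: A_def B_def\<close>)
    also have "\<dots> \<noteq> 0" using ab by (auto simp: A_def B_def in_keys_iff)
    finally have "a + b \<in> Poly_Mapping.keys (p * q)" by (simp add: in_keys_iff)
    then have "Poly_Mapping.keys (a + b) \<inter> W \<noteq> {}" using pq by (auto simp: var_ideal_def)
    then show False using ab by (auto simp: keys_add_nat A_def B_def)
  qed
qed

lemma mpoly_var_in_carrier: "mpoly_var x \<in> carrier (mpoly_ring V) \<longleftrightarrow> x \<in> V"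
  by (simp add: mpoly_carrier_iff mpoly_var_def)

lemma mpoly_var_in_var_ideal: 
  "x \<in> V \<Longrightarrow> mpoly_var x \<in> var_ideal V W \<longleftrightarrow> x \<in> W"
  using prod_var_in_var_ideal[of "{x}" V W] by auto

lemma var_ideal_subset_iff:
  assumes "W \<subseteq> V"
  shows "(var_ideal V W :: (('x \<Rightarrow>\<^sub>0 nat) \<Rightarrow>\<^sub>0 'k::field) set) \<subseteq> var_ideal V W' \<longleftrightarrow> W \<subseteq> W'"
proof
  assume sub: "(var_ideal V W :: (('x \<Rightarrow>\<^sub>0 nat) \<Rightarrow>\<^sub>0 'k) set) \<subseteq> var_ideal V W'"
  show "W \<subseteq> W'"
  proof
    fix x assume "x \<in> W"
    then have x: "x \<in> V" using assms by blast
    have "(mpoly_var x :: ('x \<Rightarrow>\<^sub>0 nat) \<Rightarrow>\<^sub>0 'k) \<in> var_ideal V W"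
      using \<open>x \<in> W\<close> by (simp add: mpoly_var_in_var_ideal[OF x])
    then have "(mpoly_var x :: ('x \<Rightarrow>\<^sub>0 nat) \<Rightarrow>\<^sub>0 'k) \<in> var_ideal V W'" using sub by blast
    then show "x \<in> W'" by (simp add: mpoly_var_in_var_ideal[OF x])
  qed
next
  assume "W \<subseteq> W'"
  then show "(var_ideal V W :: (('x \<Rightarrow>\<^sub>0 nat) \<Rightarrow>\<^sub>0 'k) set) \<subseteq> var_ideal V W'"
    by (auto simp: var_ideal_def)
qed

lemma var_ideal_eq_iff:
  assumes "W \<subseteq> V" "W' \<subseteq> V"
  shows "(var_ideal V W :: (('x \<Rightarrow>\<^sub>0 nat) \<Rightarrow>\<^sub>0 'k::field) set) = var_ideal V W' \<longleftrightarrow> W = W'"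
  by (simp add: set_eq_subset var_ideal_subset_iff[OF assms(1)] var_ideal_subset_iff[OF assms(2)])

text \<open>
  A prime ideal containing the product of the variables in \<open>f\<close> contains one of these variables,
  so the variables of a prime above a squarefree monomial ideal form a transversal.
\<close>
lemma prime_prod_var:
  assumes P: "primeideal P (mpoly_ring V :: (('x \<Rightarrow>\<^sub>0 nat) \<Rightarrow>\<^sub>0 'k::field) ring)"
    and "finite f" "f \<subseteq> V" "(\<Prod>x\<in>f. mpoly_var x) \<in> P"
  shows "\<exists>x\<in>f. mpoly_var x \<in> P"
  using assms(2-4)
proof (induction f rule: finite_induct)
  case empty
  then show ?case using mpoly_primeD(2)[OF P] by simp
next
  case (insert x f)
  have "mpoly_var x * (\<Prod>x\<in>f. mpoly_var x) \<in> P"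
    using insert.prems insert.hyps by simp
  moreover have "(\<Prod>x\<in>f. mpoly_var x :: ('x \<Rightarrow>\<^sub>0 nat) \<Rightarrow>\<^sub>0 'k) \<in> carrier (mpoly_ring V)"
    using insert by (intro prod_var_in_carrier) auto
  ultimately show ?case
    using mpoly_primeD(3)[OF P, of "mpoly_var x" "\<Prod>x\<in>f. mpoly_var x"] insert
    by (auto simp: mpoly_var_in_carrier)
qed

lemma var_ideal_le:
  assumes I: "ideal P (mpoly_ring V :: (('x \<Rightarrow>\<^sub>0 nat) \<Rightarrow>\<^sub>0 'k::field) ring)"
    and W: "\<And>x. x \<in> W \<Longrightarrow> mpoly_var x \<in> P" "W \<subseteq> V"
  shows "var_ideal V W \<subseteq> P"
proof -
  interpret R: cring "mpoly_ring V :: (('x \<Rightarrow>\<^sub>0 nat) \<Rightarrow>\<^sub>0 'k) ring" by (rule mpoly_ring_cring)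
  have "var_ideal V W = Idl\<^bsub>mpoly_ring V\<^esub> ((\<lambda>f. \<Prod>x\<in>f. mpoly_var x) ` ((\<lambda>x. {x}) ` W))"
    unfolding var_ideal_eq_monomial_ideal by (rule genideal_prod_var[symmetric]) (use W in auto)
  also have "\<dots> \<subseteq> P" by (rule R.genideal_minimal[OF I]) (use W in auto)
  finally show ?thesis .
qed

section \<open>Krull dimension of a polynomial ring\<close>

text \<open>
  Bounding each exponent instead of the total degree bounds the number of monomials by a
  plain power.
\<close>
definition exponent_box :: "'x set \<Rightarrow> nat \<Rightarrow> ('x \<Rightarrow>\<^sub>0 nat) set" where
  "exponent_box V M = {m. Poly_Mapping.keys m \<subseteq> V \<and> (\<forall>x. Poly_Mapping.lookup m x \<le> M)}"

lemma exponent_box_finite_card: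
  assumes "finite V"
  shows "finite (exponent_box V M) \<and> card (exponent_box V M) \<le> (M + 1) ^ card V"
proof -
  let ?r = "\<lambda>m :: 'a \<Rightarrow>\<^sub>0 nat. restrict (Poly_Mapping.lookup m) V"
  have inj: "inj_on ?r (exponent_box V M)"
  proof (rule inj_onI)
    fix m n assume mn: "m \<in> exponent_box V M" "n \<in> exponent_box V M" "?r m = ?r n"
    show "m = n"
    proof (rule poly_mapping_eqI)
      fix x
      show "Poly_Mapping.lookup m x = Poly_Mapping.lookup n x"
      proof (cases "x \<in> V")
        case True
        then show ?thesis using fun_cong[OF mn(3), of x] by simp
      next
        case False
        then have "x \<notin> Poly_Mapping.keys m" "x \<notin> Poly_Mapping.keys n"
          using mn(1,2) by (auto simp: exponent_box_def)
        then show ?thesis by (simp add: in_keys_iff)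
      qed
    qed
  qed
  have sub: "?r ` exponent_box V M \<subseteq> PiE V (\<lambda>_. {..M})"
    by (auto simp: exponent_box_def)
  have fin: "finite (PiE V (\<lambda>_. {..M}))" using assms by (intro finite_PiE) auto
  have "card (PiE V (\<lambda>_. {..M})) = (M + 1) ^ card V"
    using assms by (simp add: card_PiE)
  then show ?thesis
    using inj_on_finite[OF inj sub fin] card_inj_on_le[OF inj sub fin] by simp
qed

lemma exponent_box_mono: "M \<le> N \<Longrightarrow> exponent_box V M \<subseteq> exponent_box V N"
  unfolding exponent_box_def using order_trans by blast

lemma keys_mult_exponent_box:
  fixes p q :: "('x \<Rightarrow>\<^sub>0 nat) \<Rightarrow>\<^sub>0 'k::field"
  assumes "Poly_Mapping.keys p \<subseteq> exponent_box V M" "Poly_Mapping.keys q \<subseteq> exponent_box V N"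
  shows "Poly_Mapping.keys (p * q) \<subseteq> exponent_box V (M + N)"
proof
  fix m assume "m \<in> Poly_Mapping.keys (p * q)"
  then obtain a b where ab: "m = a + b" "a \<in> Poly_Mapping.keys p" "b \<in> Poly_Mapping.keys q"
    using Poly_Mapping.keys_mult[of p q] by blast
  then have "a \<in> exponent_box V M" "b \<in> exponent_box V N" using assms by auto
  then show "m \<in> exponent_box V (M + N)"
    by (auto simp: ab(1) exponent_box_def keys_add_nat lookup_add intro: add_mono)
qed

lemma keys_power_exponent_box:
  fixes p :: "('x \<Rightarrow>\<^sub>0 nat) \<Rightarrow>\<^sub>0 'k::field"
  assumes "Poly_Mapping.keys p \<subseteq> exponent_box V D"
  shows "Poly_Mapping.keys (p ^ n) \<subseteq> exponent_box V (n * D)"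
proof (induction n)
  case 0
  then show ?case by (simp add: exponent_box_def)
next
  case (Suc n)
  then show ?case using keys_mult_exponent_box[OF assms Suc.IH] by (simp add: algebra_simps)
qed

definition power_product :: "'a::comm_semiring_1 list \<Rightarrow> nat list \<Rightarrow> 'a" where
  "power_product xs \<alpha> = prod_list (map2 (^) xs \<alpha>)"

lemma power_product_simps [simp]:
  "power_product [] \<alpha> = 1" "power_product (x # xs) (n # \<alpha>) = x ^ n * power_product xs \<alpha>"
  by (simp_all add: power_product_def)

lemma keys_power_product_exponent_box:
  fixes xs :: "(('x \<Rightarrow>\<^sub>0 nat) \<Rightarrow>\<^sub>0 'k::field) list"
  assumes "length \<alpha> = length xs" "\<And>x. x \<in> set xs \<Longrightarrow> Poly_Mapping.keys x \<subseteq> exponent_box V D"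
    "set \<alpha> \<subseteq> {..N}"
  shows "Poly_Mapping.keys (power_product xs \<alpha>) \<subseteq> exponent_box V (length xs * (N * D))"
  using assms
proof (induction \<alpha> xs rule: list_induct2)
  case Nil
  then show ?case by (simp add: exponent_box_def)
next
  case (Cons n \<alpha> x xs)
  have "Poly_Mapping.keys (x ^ n) \<subseteq> exponent_box V (N * D)"
    using keys_power_exponent_box[of x V D n] exponent_box_mono[of "n * D" "N * D" V] Cons.prems
    by force
  moreover have "Poly_Mapping.keys (power_product xs \<alpha>) \<subseteq> exponent_box V (length xs * (N * D))"
    using Cons by simp
  ultimately show ?case
    using keys_mult_exponent_box by fastforce
qed

lemma carrier_exponent_box:
  assumes "finite V" "p \<in> carrier (mpoly_ring V)"
  shows "\<exists>D. Poly_Mapping.keys p \<subseteq> exponent_box V D"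
proof -
  let ?S = "(\<lambda>(m, x). Poly_Mapping.lookup m x) ` (Poly_Mapping.keys p \<times> V)"
  have fin: "finite ?S" using assms(1) by simp
  have "Poly_Mapping.lookup m x \<le> Max (insert 0 ?S)" if "m \<in> Poly_Mapping.keys p" for m x
  proof (cases "x \<in> V")
    case True
    then show ?thesis using that fin by (intro Max_ge) force+
  next
    case False
    then have "x \<notin> Poly_Mapping.keys m" using that assms(2) by (auto simp: mpoly_carrier_iff)
    then show ?thesis by (simp add: in_keys_iff)
  qed
  then have "Poly_Mapping.keys p \<subseteq> exponent_box V (Max (insert 0 ?S))"
    using assms(2) unfolding exponent_box_def mpoly_carrier_iff by blast
  then show ?thesis by blast
qed

lemma carrier_list_exponent_box:
  assumes "finite V" "set xs \<subseteq> carrier (mpoly_ring V)"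
  shows "\<exists>D. \<forall>x\<in>set xs. Poly_Mapping.keys x \<subseteq> exponent_box V D"
  using assms(2)
proof (induction xs)
  case Nil
  then show ?case by simp
next
  case (Cons x xs)
  obtain D E where "\<forall>x\<in>set xs. Poly_Mapping.keys x \<subseteq> exponent_box V D"
    "Poly_Mapping.keys x \<subseteq> exponent_box V E"
    using Cons carrier_exponent_box[OF assms(1), of x] by auto
  then have "\<forall>y\<in>set (x # xs). Poly_Mapping.keys y \<subseteq> exponent_box V (max D E)"
    using exponent_box_mono[of D "max D E" V] exponent_box_mono[of E "max D E" V] by auto
  then show ?case by blast
qed

lemma mpoly_vector_space:
  "vector_space (\<lambda>c (p :: ('x \<Rightarrow>\<^sub>0 nat) \<Rightarrow>\<^sub>0 'k::field). Poly_Mapping.single 0 c * p)"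
proof
  fix a b :: 'k and x y :: "('x \<Rightarrow>\<^sub>0 nat) \<Rightarrow>\<^sub>0 'k"
  show "Poly_Mapping.single 0 a * (x + y) = Poly_Mapping.single 0 a * x + Poly_Mapping.single 0 a * y"
    by (simp add: distrib_left)
  show "Poly_Mapping.single 0 (a + b) * x = Poly_Mapping.single 0 a * x + Poly_Mapping.single 0 b * x"
    by (simp add: single_add distrib_right)
  show "Poly_Mapping.single 0 a * (Poly_Mapping.single 0 b * x) = Poly_Mapping.single 0 (a * b) * x"
    by (simp add: mult_single flip: mult.assoc)
  show "Poly_Mapping.single 0 1 * x = x" by simp
qed

text \<open>
  With \<open>n\<close> variables there are \<open>(N+1)^(n+1)\<close> power products with exponents at most \<open>N\<close>, but they
  live in a space of dimension \<open>O(N^n)\<close>, since the exponents of their monomials grow linearly in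
  \<open>N\<close>.
\<close>
lemma algebraically_dependent:
  fixes xs :: "(('x \<Rightarrow>\<^sub>0 nat) \<Rightarrow>\<^sub>0 'k::field) list"
  assumes V: "finite V" and len: "length xs = Suc (card V)"
    and xs: "set xs \<subseteq> carrier (mpoly_ring V)"
  shows "\<exists>T c. finite T \<and> T \<noteq> {} \<and> (\<forall>\<alpha>\<in>T. length \<alpha> = length xs \<and> c \<alpha> \<noteq> 0) \<and>
    (\<Sum>\<alpha>\<in>T. Poly_Mapping.single 0 (c \<alpha>) * power_product xs \<alpha>) = 0"
proof -
  interpret VS: vector_space "\<lambda>c (p :: ('x \<Rightarrow>\<^sub>0 nat) \<Rightarrow>\<^sub>0 'k). Poly_Mapping.single 0 c * p"
    by (rule mpoly_vector_space)
  obtain D where D: "\<forall>x\<in>set xs. Poly_Mapping.keys x \<subseteq> exponent_box V D"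
    using carrier_list_exponent_box[OF V xs] by blast
  define k where "k = length xs"
  \<comment> \<open>With this \<open>N\<close>, the bound \<open>((k * D + 1) * (N + 1)) ^ card V\<close> on the dimension drops below the
      number \<open>(N + 1) ^ k\<close> of power products.\<close>
  define N where "N = (k * D + 1) ^ card V"
  define M where "M = k * (N * D)"
  define L where "L = {\<alpha>. set \<alpha> \<subseteq> {..N} \<and> length \<alpha> = k}"
  define B where "B = (\<lambda>m. Poly_Mapping.single m (1::'k)) ` exponent_box V M"
  have finL: "finite L" unfolding L_def by (rule finite_lists_length_eq) simp
  have cardL: "card L = (N + 1) ^ k"
    unfolding L_def by (subst card_lists_length_eq) simp_all
  have finB: "finite B" unfolding B_def using exponent_box_finite_card[OF V] by blast
  have "card B \<le> card (exponent_box V M)"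
    unfolding B_def using exponent_box_finite_card[OF V] card_image_le by blast
  also have "\<dots> \<le> (M + 1) ^ card V" using exponent_box_finite_card[OF V] by blast
  also have "\<dots> \<le> ((k * D + 1) * (N + 1)) ^ card V"
    by (intro power_mono) (simp_all add: M_def algebra_simps)
  also have "\<dots> = N * (N + 1) ^ card V"
    unfolding power_mult_distrib N_def[symmetric] ..
  also have "\<dots> < (N + 1) * (N + 1) ^ card V" by simp
  also have "\<dots> = card L" using len by (simp add: cardL k_def)
  finally have less: "card B < card L" .
  have span: "power_product xs ` L \<subseteq> VS.span B"
  proof
    fix p assume "p \<in> power_product xs ` L"
    then have keys: "Poly_Mapping.keys p \<subseteq> exponent_box V M"
      using keys_power_product_exponent_box[of _ xs V D N] D by (auto simp: L_def M_def k_def)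
    have "Poly_Mapping.single 0 (Poly_Mapping.lookup p m) * Poly_Mapping.single m 1 \<in> VS.span B"
      if "m \<in> Poly_Mapping.keys p" for m
      using keys that by (intro VS.span_scale VS.span_base) (auto simp: B_def)
    then have "(\<Sum>m\<in>Poly_Mapping.keys p. Poly_Mapping.single m (Poly_Mapping.lookup p m)) \<in> VS.span B"
      by (intro VS.span_sum) (simp add: mult_single)
    then show "p \<in> VS.span B" using mpoly_eq_sum_monomials[of p] by simp
  qed
  show ?thesis
    \<comment> \<open>Linear dependence speaks about sets of vectors, so coinciding power products give a relation
        of their own.\<close>
  proof (cases "inj_on (power_product xs) L")
    case True
    have "card (power_product xs ` L) = card L" using True by (rule card_image)
    then have "VS.dependent (power_product xs ` L)"
      using VS.independent_span_bound[OF finB _ span] less by auto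
    then obtain t u v where t: "finite t" "t \<subseteq> power_product xs ` L"
      "(\<Sum>v\<in>t. Poly_Mapping.single 0 (u v) * v) = 0" "v \<in> t" "u v \<noteq> 0"
      unfolding VS.dependent_explicit by blast
    define T where "T = {\<alpha>\<in>L. power_product xs \<alpha> \<in> t \<and> u (power_product xs \<alpha>) \<noteq> 0}"
    have injT: "inj_on (power_product xs) T" using True by (rule inj_on_subset) (auto simp: T_def)
    have "(\<Sum>\<alpha>\<in>T. Poly_Mapping.single 0 (u (power_product xs \<alpha>)) * power_product xs \<alpha>) =
        (\<Sum>v\<in>power_product xs ` T. Poly_Mapping.single 0 (u v) * v)"
      by (simp add: sum.reindex[OF injT])
    also have "\<dots> = (\<Sum>v\<in>t. Poly_Mapping.single 0 (u v) * v)"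
      using t(1,2) by (intro sum.mono_neutral_left) (auto simp: T_def)
    finally have "(\<Sum>\<alpha>\<in>T. Poly_Mapping.single 0 (u (power_product xs \<alpha>)) * power_product xs \<alpha>) = 0"
      using t(3) by simp
    moreover have "T \<noteq> {}" using t(2,4,5) by (auto simp: T_def)
    moreover have "finite T" using finL unfolding T_def by (rule finite_subset[rotated]) blast
    moreover have "\<forall>\<alpha>\<in>T. length \<alpha> = length xs \<and> u (power_product xs \<alpha>) \<noteq> 0"
      by (auto simp: T_def L_def k_def)
    ultimately show ?thesis
      by (intro exI[of _ T] exI[of _ "\<lambda>\<alpha>. u (power_product xs \<alpha>)"]) auto
  next
    case False
    then obtain \<alpha> \<beta> where ab: "\<alpha> \<in> L" "\<beta> \<in> L" "\<alpha> \<noteq> \<beta>" "power_product xs \<alpha> = power_product xs \<beta>"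
      by (auto simp: inj_on_def)
    define c :: "nat list \<Rightarrow> 'k" where "c = (\<lambda>\<gamma>. if \<gamma> = \<alpha> then 1 else - 1)"
    have "(\<Sum>\<gamma>\<in>{\<alpha>, \<beta>}. Poly_Mapping.single 0 (c \<gamma>) * power_product xs \<gamma>) =
       Poly_Mapping.single 0 (1 + (- 1)) * power_product xs \<beta>"
      using ab(3,4) by (simp add: c_def single_add distrib_right)
    also have "\<dots> = 0" by simp
    finally show ?thesis
      using ab(1,2) by (intro exI[of _ "{\<alpha>, \<beta>}"] exI[of _ c]) (auto simp: c_def L_def k_def)
  qed
qed

lemma prime_power_notin:
  assumes P: "primeideal P (mpoly_ring V :: (('x \<Rightarrow>\<^sub>0 nat) \<Rightarrow>\<^sub>0 'k::field) ring)"
    and x: "x \<in> carrier (mpoly_ring V)" "x \<notin> P"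
  shows "x ^ n \<in> carrier (mpoly_ring V) \<and> x ^ n \<notin> P"
proof (induction n)
  interpret R: cring "mpoly_ring V :: (('x \<Rightarrow>\<^sub>0 nat) \<Rightarrow>\<^sub>0 'k) ring" by (rule mpoly_ring_cring)
  case 0
  then show ?case using R.one_closed mpoly_primeD(2)[OF P] by simp
next
  interpret R: cring "mpoly_ring V :: (('x \<Rightarrow>\<^sub>0 nat) \<Rightarrow>\<^sub>0 'k) ring" by (rule mpoly_ring_cring)
  case (Suc n)
  then show ?case using R.m_closed[of x "x ^ n"] x mpoly_primeD(3)[OF P, of x "x ^ n"] by auto
qed

lemma power_product_in_carrier:
  assumes "length \<alpha> = length xs"
    "set xs \<subseteq> carrier (mpoly_ring V :: (('x \<Rightarrow>\<^sub>0 nat) \<Rightarrow>\<^sub>0 'k::field) ring)"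
  shows "power_product xs \<alpha> \<in> carrier (mpoly_ring V)"
  using assms
proof (induction \<alpha> xs rule: list_induct2)
  interpret R: cring "mpoly_ring V :: (('x \<Rightarrow>\<^sub>0 nat) \<Rightarrow>\<^sub>0 'k) ring" by (rule mpoly_ring_cring)
  case Nil
  then show ?case using R.one_closed by simp
next
  interpret R: cring "mpoly_ring V :: (('x \<Rightarrow>\<^sub>0 nat) \<Rightarrow>\<^sub>0 'k) ring" by (rule mpoly_ring_cring)
  case (Cons n \<alpha> x xs)
  have "x ^ n \<in> carrier (mpoly_ring V)"
    using Cons.prems R.m_closed R.one_closed by (induction n) auto
  then show ?case using Cons R.m_closed[of "x ^ n" "power_product xs \<alpha>"] by simp
qed

text \<open>
  Coquand and Lombardi's argument. Factoring out the smallest power of the first element \<open>x\<close>, which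
  is not in \<open>P 0\<close>, and reducing modulo \<open>x\<close> in \<open>P 1\<close> leaves a relation between the remaining
  elements modulo \<open>P 1\<close>. After the last element, a nonzero constant would be left in a prime.
\<close>
lemma prime_chain_no_relation:
  fixes xs :: "(('x \<Rightarrow>\<^sub>0 nat) \<Rightarrow>\<^sub>0 'k::field) list"
  assumes "\<And>i. i \<le> length xs \<Longrightarrow> primeideal (P i) (mpoly_ring V)"
    and "\<And>i. i < length xs \<Longrightarrow> P i \<subseteq> P (Suc i) \<and> xs ! i \<in> P (Suc i) \<and> xs ! i \<notin> P i"
    and "finite T" "T \<noteq> {}" "\<And>\<alpha>. \<alpha> \<in> T \<Longrightarrow> length \<alpha> = length xs \<and> c \<alpha> \<noteq> 0"
  shows "(\<Sum>\<alpha>\<in>T. Poly_Mapping.single 0 (c \<alpha>) * power_product xs \<alpha>) \<notin> P 0"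
  using assms
proof (induction xs arbitrary: P T c)
  case Nil
  interpret R: cring "mpoly_ring V :: (('x \<Rightarrow>\<^sub>0 nat) \<Rightarrow>\<^sub>0 'k) ring" by (rule mpoly_ring_cring)
  have P: "primeideal (P 0) (mpoly_ring V)" using Nil by simp
  have T: "T = {[]}" using Nil(4,5) by force
  have c: "c [] \<noteq> 0" using Nil(5) T by blast
  have "Poly_Mapping.single 0 (c []) \<notin> P 0"
  proof
    assume "Poly_Mapping.single 0 (c []) \<in> P 0"
    moreover have "Poly_Mapping.single 0 (inverse (c [])) \<in> carrier (mpoly_ring V)"
      by (simp add: mpoly_carrier_iff)
    ultimately have "Poly_Mapping.single 0 (inverse (c [])) * Poly_Mapping.single 0 (c []) \<in> P 0"
      by (rule mpoly_idealD(4)[OF mpoly_primeD(1)[OF P]])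
    then show False using c mpoly_primeD(2)[OF P] by (simp add: mult_single)
  qed
  then show ?case by (simp add: T)
next
  case (Cons x xs)
  interpret R: cring "mpoly_ring V :: (('x \<Rightarrow>\<^sub>0 nat) \<Rightarrow>\<^sub>0 'k) ring" by (rule mpoly_ring_cring)
  have P: "primeideal (P i) (mpoly_ring V)" if "i \<le> Suc (length xs)" for i
    using Cons.prems(1) that by simp
  have P0: "primeideal (P 0) (mpoly_ring V)" and P1: "primeideal (P 1) (mpoly_ring V)"
    using P[of 0] P[of 1] by simp_all
  note I1 = mpoly_primeD(1)[OF P1]
  have step: "P i \<subseteq> P (Suc i)" "(x # xs) ! i \<in> P (Suc i)" "(x # xs) ! i \<notin> P i"
    if "i \<le> length xs" for i
    using Cons.prems(2) that by auto
  have x: "x \<in> P 1" "x \<notin> P 0" "P 0 \<subseteq> P 1" using step[of 0] by auto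
  have xc: "x \<in> carrier (mpoly_ring V)" using x(1) mpoly_idealD(1)[OF I1] by auto
  have xsc: "set xs \<subseteq> carrier (mpoly_ring V)"
  proof
    fix y assume "y \<in> set xs"
    then obtain i where "i < length xs" "y = xs ! i" by (auto simp: in_set_conv_nth)
    then show "y \<in> carrier (mpoly_ring V)"
      using step(2)[of "Suc i"] mpoly_idealD(1)[OF mpoly_primeD(1)[OF P[of "Suc (Suc i)"]]] by auto
  qed
  define m where "m = Min (hd ` T)"
  have T: "\<alpha> = hd \<alpha> # tl \<alpha>" "length (tl \<alpha>) = length xs" "c \<alpha> \<noteq> 0" "m \<le> hd \<alpha>" if "\<alpha> \<in> T" for \<alpha>
    using Cons.prems(5)[OF that] Cons.prems(3) that by (auto simp: m_def length_Suc_conv)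
  define g where "g = (\<lambda>\<alpha>. Poly_Mapping.single 0 (c \<alpha>) * power_product xs (tl \<alpha>))"
  define T1 where "T1 = {\<alpha>\<in>T. hd \<alpha> = m}"
  have gc: "g \<alpha> \<in> carrier (mpoly_ring V)" if "\<alpha> \<in> T" for \<alpha>
  proof -
    have "Poly_Mapping.single 0 (c \<alpha>) \<in> carrier (mpoly_ring V)" by (simp add: mpoly_carrier_iff)
    then show ?thesis
      using R.m_closed[of "Poly_Mapping.single 0 (c \<alpha>)" "power_product xs (tl \<alpha>)"]
        power_product_in_carrier[OF T(2)[OF that] xsc] by (simp add: g_def)
  qed
  have xpc: "x ^ n \<in> carrier (mpoly_ring V)" for n
    using prime_power_notin[OF P0 xc x(2)] by blast
  let ?q = "\<Sum>\<alpha>\<in>T. x ^ (hd \<alpha> - m) * g \<alpha>"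
  have qc: "?q \<in> carrier (mpoly_ring V)"
    by (rule mpoly_ideal_sum[OF R.oneideal]) (use R.m_closed gc xpc in auto)
  have factor: "(\<Sum>\<alpha>\<in>T. Poly_Mapping.single 0 (c \<alpha>) * power_product (x # xs) \<alpha>) = x ^ m * ?q"
    unfolding sum_distrib_left
  proof (rule sum.cong[OF refl])
    fix \<alpha> assume a: "\<alpha> \<in> T"
    have "power_product (x # xs) \<alpha> = x ^ hd \<alpha> * power_product xs (tl \<alpha>)"
      by (subst T(1)[OF a]) simp
    also have "x ^ hd \<alpha> = x ^ m * x ^ (hd \<alpha> - m)"
      using T(4)[OF a] by (simp flip: power_add)
    finally show "Poly_Mapping.single 0 (c \<alpha>) * power_product (x # xs) \<alpha> = x ^ m * (x ^ (hd \<alpha> - m) * g \<alpha>)"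
      by (simp add: g_def mult_ac)
  qed
  show ?case
  proof
    assume "(\<Sum>\<alpha>\<in>T. Poly_Mapping.single 0 (c \<alpha>) * power_product (x # xs) \<alpha>) \<in> P 0"
    then have "?q \<in> P 0"
      unfolding factor using mpoly_primeD(3)[OF P0 xpc qc] prime_power_notin[OF P0 xc x(2)] by blast
    then have q1: "?q \<in> P 1" using x(3) by blast
    have rest: "(\<Sum>\<alpha>\<in>T - T1. x ^ (hd \<alpha> - m) * g \<alpha>) \<in> P 1"
    proof (rule mpoly_ideal_sum[OF I1])
      fix \<alpha> assume a: "\<alpha> \<in> T - T1"
      then have "m < hd \<alpha>" using T(4)[of \<alpha>] by (auto simp: T1_def)
      then obtain d where d: "hd \<alpha> - m = Suc d" by (metis Suc_diff_Suc)
      have "(x ^ d * g \<alpha>) * x \<in> P 1"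
        using R.m_closed[OF xpc gc] a by (intro mpoly_idealD(4)[OF I1 x(1)]) auto
      then show "x ^ (hd \<alpha> - m) * g \<alpha> \<in> P 1" by (simp add: d mult_ac)
    qed
    have split: "?q = (\<Sum>\<alpha>\<in>T - T1. x ^ (hd \<alpha> - m) * g \<alpha>) + (\<Sum>\<alpha>\<in>T1. g \<alpha>)"
      using sum.subset_diff[of T1 T "\<lambda>\<alpha>. x ^ (hd \<alpha> - m) * g \<alpha>"] Cons.prems(3)
      by (auto simp: T1_def)
    have "- 1 \<in> carrier (mpoly_ring V :: (('x \<Rightarrow>\<^sub>0 nat) \<Rightarrow>\<^sub>0 'k) ring)"
      by (simp add: mpoly_carrier_iff flip: single_uminus single_one)
    then have "?q + (- 1) * (\<Sum>\<alpha>\<in>T - T1. x ^ (hd \<alpha> - m) * g \<alpha>) \<in> P 1"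
      by (intro mpoly_idealD(3)[OF I1 q1] mpoly_idealD(4)[OF I1 rest])
    then have "(\<Sum>\<alpha>\<in>T1. g \<alpha>) \<in> P 1" unfolding split by simp
    moreover have "(\<Sum>\<alpha>\<in>T1. g \<alpha>) =
        (\<Sum>\<beta>\<in>tl ` T1. Poly_Mapping.single 0 (c (m # \<beta>)) * power_product xs \<beta>)"
    proof -
      have eq: "m # tl \<alpha> = \<alpha>" if "\<alpha> \<in> T1" for \<alpha> using T(1)[of \<alpha>] that by (auto simp: T1_def)
      have "inj_on tl T1" by (rule inj_onI) (metis eq)
      then show ?thesis by (simp add: sum.reindex g_def eq)
    qed
    moreover have "(\<Sum>\<beta>\<in>tl ` T1. Poly_Mapping.single 0 (c (m # \<beta>)) * power_product xs \<beta>) \<notin> (P \<circ> Suc) 0"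
    proof (rule Cons.IH)
      have "m \<in> hd ` T" unfolding m_def using Cons.prems(3,4) by (intro Min_in) auto
      then show "tl ` T1 \<noteq> {}" by (auto simp: T1_def)
      show "finite (tl ` T1)" using Cons.prems(3) by (simp add: T1_def)
      show "length \<beta> = length xs \<and> c (m # \<beta>) \<noteq> 0" if "\<beta> \<in> tl ` T1" for \<beta>
        using that T(1-3) by (auto simp: T1_def)
      show "primeideal ((P \<circ> Suc) i) (mpoly_ring V)" if "i \<le> length xs" for i
        using P[of "Suc i"] that by simp
      show "(P \<circ> Suc) i \<subseteq> (P \<circ> Suc) (Suc i) \<and> xs ! i \<in> (P \<circ> Suc) (Suc i) \<and> xs ! i \<notin> (P \<circ> Suc) i"
        if "i < length xs" for i
        using step[of "Suc i"] that by simp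
    qed
    ultimately show False by simp
  qed
qed

lemma mpoly_prime_chain_length:
  assumes V: "finite V" and chain: "prime_chain (mpoly_ring V :: (('x \<Rightarrow>\<^sub>0 nat) \<Rightarrow>\<^sub>0 'k::field) ring) n P"
  shows "n \<le> card V"
proof (rule ccontr)
  assume "\<not> ?thesis"
  then have k: "Suc (card V) \<le> n" by simp
  have "\<exists>x. x \<in> P (Suc i) \<and> x \<notin> P i" if "i < n" for i
    using chain that unfolding prime_chain_def by blast
  then obtain x where x: "\<And>i. i < n \<Longrightarrow> x i \<in> P (Suc i) \<and> x i \<notin> P i" by metis
  have P: "primeideal (P i) (mpoly_ring V)" if "i \<le> n" for i
    using chain that unfolding prime_chain_def by blast
  define xs where "xs = map x [0..<Suc (card V)]"
  have len: "length xs = Suc (card V)" by (simp add: xs_def)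
  have nth: "xs ! i = x i" if "i < Suc (card V)" for i
    using that unfolding xs_def by (metis add_0 diff_zero length_upt nth_map nth_upt)
  have "x i \<in> carrier (mpoly_ring V)" if "i < Suc (card V)" for i
    using x[of i] k that mpoly_idealD(1)[OF mpoly_primeD(1)[OF P[of "Suc i"]]] by auto
  then have "set xs \<subseteq> carrier (mpoly_ring V)" by (auto simp: xs_def)
  then obtain T c where T: "finite T" "T \<noteq> {}" "\<And>\<alpha>. \<alpha> \<in> T \<Longrightarrow> length \<alpha> = length xs \<and> c \<alpha> \<noteq> 0"
    "(\<Sum>\<alpha>\<in>T. Poly_Mapping.single 0 (c \<alpha>) * power_product xs \<alpha>) = 0"
    using algebraically_dependent[OF V len] by blast
  have "(\<Sum>\<alpha>\<in>T. Poly_Mapping.single 0 (c \<alpha>) * power_product xs \<alpha>) \<notin> P 0"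
  proof (rule prime_chain_no_relation[OF _ _ T(1-3)])
    show "primeideal (P i) (mpoly_ring V)" if "i \<le> length xs" for i
      using P that k len by simp
    show "P i \<subseteq> P (Suc i) \<and> xs ! i \<in> P (Suc i) \<and> xs ! i \<notin> P i" if "i < length xs" for i
    proof -
      have i: "i < n" "i < Suc (card V)" using that k len by auto
      have "P i \<subset> P (Suc i)" using chain i(1) unfolding prime_chain_def by blast
      then show ?thesis using x[OF i(1)] nth[OF i(2)] by auto
    qed
  qed
  then show False using T(4) mpoly_idealD(2)[OF mpoly_primeD(1)[OF P[of 0]]] by simp
qed

section \<open>Height and dimension of squarefree monomial ideals\<close>

lemma prime_chain_snoc:
  assumes "prime_chain R n P" "primeideal Q R" "P n \<subset> Q"
  shows "\<exists>P'. prime_chain R (Suc n) P' \<and> P' 0 = P 0 \<and> P' (Suc n) = Q"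
  using assms unfolding prime_chain_def
  by (intro exI[of _ "P(Suc n := Q)"]) (auto simp: less_Suc_eq le_Suc_eq)

lemma prime_chain_append:
  assumes P: "prime_chain R n P" and Q: "prime_chain R m Q" and eq: "P n = Q 0"
  shows "\<exists>P'. prime_chain R (n + m) P' \<and> P' 0 = P 0 \<and> P' (n + m) = Q m"
  using Q
proof (induction m)
  case 0
  then show ?case using P eq by auto
next
  case (Suc m)
  have "prime_chain R m Q" using Suc.prems by (auto simp: prime_chain_def)
  then obtain P' where P': "prime_chain R (n + m) P'" "P' 0 = P 0" "P' (n + m) = Q m"
    using Suc.IH by blast
  have "primeideal (Q (Suc m)) R" "P' (n + m) \<subset> Q (Suc m)"
    using Suc.prems P'(3) by (auto simp: prime_chain_def)
  from prime_chain_snoc[OF P'(1) this] show ?case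
    using P'(2) by simp
qed

lemma prime_chain_replace_top:
  assumes "prime_chain R n P" "primeideal Q R" "P n \<subseteq> Q"
  shows "\<exists>P'. prime_chain R n P' \<and> P' n = Q"
  using assms unfolding prime_chain_def by (intro exI[of _ "P(n := Q)"]) auto

lemma var_ideal_chain:
  assumes "finite D" "D \<inter> W = {}" "W \<union> D \<subseteq> V"
  shows "\<exists>P. prime_chain (mpoly_ring V :: (('x \<Rightarrow>\<^sub>0 nat) \<Rightarrow>\<^sub>0 'k::field) ring) (card D) P \<and>
    P 0 = var_ideal V W \<and> P (card D) = var_ideal V (W \<union> D)"
  using assms
proof (induction D rule: finite_induct)
  case empty
  then show ?case
    by (intro exI[of _ "\<lambda>_. var_ideal V W"]) (simp add: prime_chain_def var_ideal_prime)
next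
  case (insert x D)
  obtain P where P: "prime_chain (mpoly_ring V :: (('x \<Rightarrow>\<^sub>0 nat) \<Rightarrow>\<^sub>0 'k) ring) (card D) P"
    "P 0 = var_ideal V W" "P (card D) = var_ideal V (W \<union> D)"
    using insert by auto
  let ?Q = "var_ideal V (W \<union> insert x D) :: (('x \<Rightarrow>\<^sub>0 nat) \<Rightarrow>\<^sub>0 'k) set"
  have "W \<union> D \<subseteq> V" "W \<union> insert x D \<subseteq> V" "W \<union> D \<subset> W \<union> insert x D"
    using insert.hyps insert.prems by auto
  then have "P (card D) \<subset> ?Q"
    unfolding P(3) psubset_eq by (simp only: var_ideal_subset_iff var_ideal_eq_iff simp_thms)
  from prime_chain_snoc[OF P(1) var_ideal_prime this] show ?case
    using P(2) insert.hyps by simp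
qed

text \<open>The primes generated by ever larger subsets of \<open>W\<close> form a chain below \<open>Q\<close>.\<close>
lemma prime_chain_ending_above_var_ideal:
  assumes "finite V" "W \<subseteq> V" "primeideal Q (mpoly_ring V :: (('x \<Rightarrow>\<^sub>0 nat) \<Rightarrow>\<^sub>0 'k::field) ring)"
    "var_ideal V W \<subseteq> Q"
  shows "\<exists>P. prime_chain (mpoly_ring V) (card W) P \<and> P (card W) = Q"
proof -
  obtain P where P: "prime_chain (mpoly_ring V :: (('x \<Rightarrow>\<^sub>0 nat) \<Rightarrow>\<^sub>0 'k) ring) (card W) P"
    "P (card W) = var_ideal V ({} \<union> W)"
    using var_ideal_chain[of W "{}" V] finite_subset[OF assms(2,1)] assms(2) by auto
  then show ?thesis using prime_chain_replace_top[OF P(1) assms(3)] assms(4) by simp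
qed

definition transversals :: "'x set \<Rightarrow> 'x set set \<Rightarrow> 'x set set" where
  "transversals V F = {W. W \<subseteq> V \<and> (\<forall>f\<in>F. f \<inter> W \<noteq> {})}"

text \<open>The vertex cover number of the hypergraph \<open>F\<close>.\<close>
definition transversal_number :: "'x set \<Rightarrow> 'x set set \<Rightarrow> nat" where
  "transversal_number V F = Min (card ` transversals V F)"

lemma finite_transversals: "finite V \<Longrightarrow> finite (transversals V F)"
  by (auto simp: transversals_def)

lemma transversal_number_le:
  "finite V \<Longrightarrow> W \<in> transversals V F \<Longrightarrow> transversal_number V F \<le> card W"
  by (simp add: transversal_number_def finite_transversals)

lemma transversal_number_attained:
  assumes "finite V" "transversals V F \<noteq> {}"
  obtains W where "W \<in> transversals V F" "card W = transversal_number V F"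
proof -
  have "Min (card ` transversals V F) \<in> card ` transversals V F"
    using assms by (intro Min_in) (auto simp: finite_transversals)
  then show thesis using that unfolding transversal_number_def by auto
qed

lemma monomial_ideal_subset_var_ideal:
  assumes "W \<in> transversals V F"
  shows "monomial_ideal V F \<subseteq> var_ideal V W"
  using assms unfolding transversals_def monomial_ideal_def var_ideal_def by fast

lemma prime_above_monomial_ideal:
  assumes F: "\<And>f. f \<in> F \<Longrightarrow> finite f \<and> f \<subseteq> V"
    and Q: "primeideal Q (mpoly_ring V :: (('x \<Rightarrow>\<^sub>0 nat) \<Rightarrow>\<^sub>0 'k::field) ring)" "monomial_ideal V F \<subseteq> Q"
  obtains W where "W \<in> transversals V F" "var_ideal V W \<subseteq> Q"
proof
  let ?W = "{x\<in>V. mpoly_var x \<in> Q}"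
  show "var_ideal V ?W \<subseteq> Q" by (rule var_ideal_le[OF mpoly_primeD(1)[OF Q(1)]]) auto
  have "f \<inter> ?W \<noteq> {}" if f: "f \<in> F" for f
  proof -
    have "(\<Prod>x\<in>f. mpoly_var x) \<in> Q"
      using Q(2) prod_var_in_monomial_ideal[of f V F] F[OF f] f by blast
    then show ?thesis using prime_prod_var[OF Q(1)] F[OF f] by blast
  qed
  then show "?W \<in> transversals V F" by (auto simp: transversals_def)
qed

lemma prime_height_var_ideal_le:
  assumes "finite V" "W \<subseteq> V"
  shows "prime_height (mpoly_ring V) (var_ideal V W :: (('x \<Rightarrow>\<^sub>0 nat) \<Rightarrow>\<^sub>0 'k::field) set) \<le> card W"
  unfolding prime_height_def
proof (rule SUP_least)
  fix n assume "n \<in> {n. \<exists>P. prime_chain (mpoly_ring V) n P \<and> P n = (var_ideal V W :: (('x \<Rightarrow>\<^sub>0 nat) \<Rightarrow>\<^sub>0 'k) set)}"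
  then obtain P where P: "prime_chain (mpoly_ring V) n P" "P n = (var_ideal V W :: (('x \<Rightarrow>\<^sub>0 nat) \<Rightarrow>\<^sub>0 'k) set)"
    by blast
  obtain P' where P': "prime_chain (mpoly_ring V :: (('x \<Rightarrow>\<^sub>0 nat) \<Rightarrow>\<^sub>0 'k) ring) (card (V - W)) P'"
    "P' 0 = var_ideal V W"
    using var_ideal_chain[of "V - W" W V] assms by auto
  have "n + card (V - W) \<le> card V"
    using prime_chain_append[OF P(1) P'(1)] P(2) P'(2) mpoly_prime_chain_length[OF assms(1)] by metis
  moreover have "card W \<le> card V" using assms by (simp add: card_mono)
  ultimately have "n \<le> card W"
    using card_Diff_subset[OF finite_subset[OF assms(2,1)] assms(2)] by linarith
  then show "ereal (real n) \<le> ereal (real (card W))" by simp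
qed

text \<open>
  The height of a variable prime is the number of its variables: chains below it extend by
  the remaining variables to chains of length at most \<open>card V\<close>.
\<close>
lemma ideal_height_monomial_ideal:
  assumes V: "finite V" and F: "\<And>f. f \<in> F \<Longrightarrow> f \<subseteq> V" and ne: "transversals V F \<noteq> {}"
  shows "ideal_height (mpoly_ring V) (monomial_ideal V F :: (('x \<Rightarrow>\<^sub>0 nat) \<Rightarrow>\<^sub>0 'k::field) set) =
    ereal (real (transversal_number V F))"
proof (rule antisym)
  let ?S = "mpoly_ring V :: (('x \<Rightarrow>\<^sub>0 nat) \<Rightarrow>\<^sub>0 'k) ring"
  let ?I = "monomial_ideal V F :: (('x \<Rightarrow>\<^sub>0 nat) \<Rightarrow>\<^sub>0 'k) set"
  obtain W where W: "W \<in> transversals V F" "card W = transversal_number V F"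
    using transversal_number_attained[OF V ne] .
  have "W \<subseteq> V" using W(1) by (simp add: transversals_def)
  have "ideal_height ?S ?I \<le> prime_height ?S (var_ideal V W)"
    unfolding ideal_height_def
    by (rule INF_lower) (simp add: var_ideal_prime monomial_ideal_subset_var_ideal[OF W(1)])
  also have "\<dots> \<le> ereal (real (transversal_number V F))"
    using prime_height_var_ideal_le[OF V \<open>W \<subseteq> V\<close>] W(2) by simp
  finally show "ideal_height ?S ?I \<le> ereal (real (transversal_number V F))" .
  show "ereal (real (transversal_number V F)) \<le> ideal_height ?S ?I"
    unfolding ideal_height_def
  proof (rule INF_greatest)
    fix Q assume "Q \<in> {Q. primeideal Q ?S \<and> ?I \<subseteq> Q}"
    then have Q: "primeideal Q ?S" "?I \<subseteq> Q" by auto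
    have F': "\<And>f. f \<in> F \<Longrightarrow> finite f \<and> f \<subseteq> V" using F V finite_subset by blast
    obtain W where W: "W \<in> transversals V F" "var_ideal V W \<subseteq> Q"
      using prime_above_monomial_ideal[OF F' Q] .
    then obtain P where "prime_chain ?S (card W) P" "P (card W) = Q"
      using prime_chain_ending_above_var_ideal[OF V _ Q(1) W(2)] by (auto simp: transversals_def)
    then have "ereal (real (card W)) \<le> prime_height ?S Q"
      unfolding prime_height_def by (intro SUP_upper) blast
    then show "ereal (real (transversal_number V F)) \<le> prime_height ?S Q"
      using transversal_number_le[OF V W(1)] by (meson ereal_less_eq(3) of_nat_le_iff order_trans)
  qed
qed

lemma coset_in_image_iff:
  assumes "cring R" "ideal I R" "ideal J R" "I \<subseteq> J" "a \<in> carrier R"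
  shows "I +>\<^bsub>R\<^esub> a \<in> (+>\<^bsub>R\<^esub>) I ` J \<longleftrightarrow> a \<in> J"
proof -
  interpret cring R by fact
  have "ideal ((+>\<^bsub>R\<^esub>) I ` J) (R Quot I)" by (rule ring_ideal_imp_quot_ideal[OF assms(2,3)])
  then have "(+>\<^bsub>R\<^esub>) I ` J \<subseteq> carrier (R Quot I)"
    by (rule additive_subgroup.a_subset[OF ideal.axioms(1)])
  from canonical_proj_vimage_mem_iff[OF assms(2) this assms(5)]
  have "a \<in> \<Union> ((+>\<^bsub>R\<^esub>) I ` J) \<longleftrightarrow> I +>\<^bsub>R\<^esub> a \<in> (+>\<^bsub>R\<^esub>) I ` J" .
  moreover have "J = \<Union> ((+>\<^bsub>R\<^esub>) I ` J)" using ideal_incl_iff[OF assms(2,3)] assms(4) by blast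
  ultimately show ?thesis by metis
qed

lemma primeideal_quot_image:
  assumes R: "cring R" and I: "ideal I R" and J: "primeideal J R" and sub: "I \<subseteq> J"
  shows "primeideal ((+>\<^bsub>R\<^esub>) I ` J) (R Quot I)"
proof -
  interpret R: cring R by fact
  interpret I: ideal I R by fact
  interpret J: primeideal J R by fact
  note mem = coset_in_image_iff[OF R I J.is_ideal sub]
  show ?thesis
  proof (rule primeidealI[OF R.ring_ideal_imp_quot_ideal[OF I J.is_ideal] I.quotient_is_cring[OF R]])
    have "I +>\<^bsub>R\<^esub> \<one>\<^bsub>R\<^esub> \<in> carrier (R Quot I)"
      using I.rcos_ring_hom ring_hom_closed by fastforce
    moreover have "I +>\<^bsub>R\<^esub> \<one>\<^bsub>R\<^esub> \<notin> (+>\<^bsub>R\<^esub>) I ` J"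
      using mem[of "\<one>\<^bsub>R\<^esub>"] J.I_notcarr J.one_imp_carrier by auto
    ultimately show "carrier (R Quot I) \<noteq> (+>\<^bsub>R\<^esub>) I ` J" by blast
    fix a b assume ab: "a \<in> carrier (R Quot I)" "b \<in> carrier (R Quot I)"
      and prod: "a \<otimes>\<^bsub>R Quot I\<^esub> b \<in> (+>\<^bsub>R\<^esub>) I ` J"
    obtain x y where xy: "x \<in> carrier R" "a = I +>\<^bsub>R\<^esub> x" "y \<in> carrier R" "b = I +>\<^bsub>R\<^esub> y"
      using ab unfolding FactRing_def A_RCOSETS_def' by auto
    have "I +>\<^bsub>R\<^esub> (x \<otimes>\<^bsub>R\<^esub> y) \<in> (+>\<^bsub>R\<^esub>) I ` J"
      using prod xy I.rcoset_mult_add by (simp add: FactRing_def)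
    then have "x \<in> J \<or> y \<in> J" using mem[of "x \<otimes>\<^bsub>R\<^esub> y"] J.I_prime xy by simp
    then show "a \<in> (+>\<^bsub>R\<^esub>) I ` J \<or> b \<in> (+>\<^bsub>R\<^esub>) I ` J" using xy by blast
  qed
qed

text \<open>
  Preimages and images under the projection take primes to primes and, for ideals above \<open>I\<close>,
  preserve strict inclusions.
\<close>
lemma prime_chain_quot_iff:
  assumes R: "cring R" and I: "ideal I R"
  shows "(\<exists>P. prime_chain (R Quot I) n P) \<longleftrightarrow> (\<exists>P. prime_chain R n P \<and> I \<subseteq> P 0)"
proof
  interpret R: cring R by fact
  interpret I: ideal I R by fact
  {
    assume "\<exists>P. prime_chain (R Quot I) n P"
    then obtain P where P: "\<And>i. i \<le> n \<Longrightarrow> primeideal (P i) (R Quot I)"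
      "\<And>i. i < n \<Longrightarrow> P i \<subset> P (Suc i)"
      unfolding prime_chain_def by blast
    define Q where "Q = (\<lambda>i. {r \<in> carrier R. I +>\<^bsub>R\<^esub> r \<in> P i})"
    have "primeideal (Q i) R" if "i \<le> n" for i
      unfolding Q_def
      by (rule ring_hom_ring.primeideal_vimage[OF I.rcos_ring_hom_ring R P(1)[OF that]])
    moreover have "Q i \<subset> Q (Suc i)" if i: "i < n" for i
    proof -
      obtain a where a: "a \<in> P (Suc i)" "a \<notin> P i" using P(2)[OF i] by blast
      interpret J: primeideal "P (Suc i)" "R Quot I" using P(1)[of "Suc i"] i by simp
      obtain x where "x \<in> carrier R" "a = I +>\<^bsub>R\<^esub> x"
        using J.a_subset a(1) unfolding FactRing_def A_RCOSETS_def' by auto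
      then have "x \<in> Q (Suc i)" "x \<notin> Q i" using a by (auto simp: Q_def)
      then show ?thesis using P(2)[OF i] by (auto simp: Q_def)
    qed
    moreover have "I \<subseteq> Q 0"
    proof
      fix x assume x: "x \<in> I"
      interpret J: primeideal "P 0" "R Quot I" using P(1)[of 0] by simp
      have "I +>\<^bsub>R\<^esub> x = I" using x by (rule I.a_rcos_const)
      also have "I \<in> P 0"
        using additive_subgroup.zero_closed[OF J.additive_subgroup_axioms] by (simp add: FactRing_def)
      finally show "x \<in> Q 0" using x I.a_Hcarr by (simp add: Q_def)
    qed
    ultimately show "\<exists>P. prime_chain R n P \<and> I \<subseteq> P 0" unfolding prime_chain_def by blast
  }
  assume "\<exists>P. prime_chain R n P \<and> I \<subseteq> P 0"
  then obtain P where P: "\<And>i. i \<le> n \<Longrightarrow> primeideal (P i) R" "\<And>i. i < n \<Longrightarrow> P i \<subset> P (Suc i)" "I \<subseteq> P 0"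
    unfolding prime_chain_def by blast
  have above: "I \<subseteq> P i" if "i \<le> n" for i
    using that by (induction i) (use P(2,3) in \<open>auto simp: Suc_le_eq\<close>)
  have "(+>\<^bsub>R\<^esub>) I ` P i \<subset> (+>\<^bsub>R\<^esub>) I ` P (Suc i)" if i: "i < n" for i
  proof -
    interpret J: primeideal "P i" R using P(1)[of i] i by simp
    interpret J': primeideal "P (Suc i)" R using P(1)[of "Suc i"] i by simp
    obtain a where a: "a \<in> P (Suc i)" "a \<notin> P i" using P(2)[OF i] by blast
    then have "I +>\<^bsub>R\<^esub> a \<notin> (+>\<^bsub>R\<^esub>) I ` P i"
      using coset_in_image_iff[OF R I J.is_ideal above[of i]] i J'.a_Hcarr by simp
    then show ?thesis using a(1) P(2)[OF i] by blast
  qed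
  then have "prime_chain (R Quot I) n (\<lambda>i. (+>\<^bsub>R\<^esub>) I ` P i)"
    unfolding prime_chain_def using primeideal_quot_image[OF R I P(1) above] by blast
  then show "\<exists>P. prime_chain (R Quot I) n P" by blast
qed

text \<open>
  A chain above the ideal starts at a prime containing a variable prime of some transversal \<open>W\<close>,
  and is prolonged downwards by the \<open>card W\<close> steps from zero to its first member.
\<close>
lemma krull_dim_quot_monomial_ideal:
  assumes V: "finite V" and F: "\<And>f. f \<in> F \<Longrightarrow> f \<subseteq> V" and ne: "transversals V F \<noteq> {}"
  shows "krull_dim (mpoly_ring V Quot (monomial_ideal V F :: (('x \<Rightarrow>\<^sub>0 nat) \<Rightarrow>\<^sub>0 'k::field) set)) =
    ereal (real (card V)) - ereal (real (transversal_number V F))"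
proof -
  let ?S = "mpoly_ring V :: (('x \<Rightarrow>\<^sub>0 nat) \<Rightarrow>\<^sub>0 'k) ring"
  let ?I = "monomial_ideal V F :: (('x \<Rightarrow>\<^sub>0 nat) \<Rightarrow>\<^sub>0 'k) set"
  have F': "\<And>f. f \<in> F \<Longrightarrow> finite f \<and> f \<subseteq> V" using F V finite_subset by blast
  have dim: "krull_dim (?S Quot ?I) = (SUP n\<in>{n. \<exists>P. prime_chain ?S n P \<and> ?I \<subseteq> P 0}. ereal (real n))"
    unfolding krull_dim_def prime_chain_quot_iff[OF mpoly_ring_cring monomial_ideal_ideal] ..
  obtain W where W: "W \<in> transversals V F" "card W = transversal_number V F"
    using transversal_number_attained[OF V ne] .
  have WV: "W \<subseteq> V" using W(1) by (simp add: transversals_def)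
  have card: "card (V - W) = card V - transversal_number V F" "transversal_number V F \<le> card V"
    using card_Diff_subset[OF finite_subset[OF WV V] WV] W(2) card_mono[OF V WV] by auto
  have "krull_dim (?S Quot ?I) = ereal (real (card V - transversal_number V F))"
    unfolding dim
  proof (rule antisym)
    obtain P where "prime_chain ?S (card (V - W)) P" "P 0 = var_ideal V W"
      using var_ideal_chain[of "V - W" W V] V WV by auto
    then show "ereal (real (card V - transversal_number V F)) \<le>
        (SUP n\<in>{n. \<exists>P. prime_chain ?S n P \<and> ?I \<subseteq> P 0}. ereal (real n))"
      using monomial_ideal_subset_var_ideal[OF W(1)] card(1) by (intro SUP_upper) auto
    show "(SUP n\<in>{n. \<exists>P. prime_chain ?S n P \<and> ?I \<subseteq> P 0}. ereal (real n)) \<le>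
        ereal (real (card V - transversal_number V F))"
    proof (rule SUP_least)
      fix n assume "n \<in> {n. \<exists>P. prime_chain ?S n P \<and> ?I \<subseteq> P 0}"
      then obtain P where P: "prime_chain ?S n P" "?I \<subseteq> P 0" by blast
      have P0: "primeideal (P 0) ?S" using P(1) by (simp add: prime_chain_def)
      obtain W' where W': "W' \<in> transversals V F" "var_ideal V W' \<subseteq> P 0"
        using prime_above_monomial_ideal[OF F' P0 P(2)] .
      then obtain P' where P': "prime_chain ?S (card W') P'" "P' (card W') = P 0"
        using prime_chain_ending_above_var_ideal[OF V _ P0 W'(2)] by (auto simp: transversals_def)
      have "card W' + n \<le> card V"
        using prime_chain_append[OF P'(1) P(1) P'(2)] mpoly_prime_chain_length[OF V] by blast
      then have "n \<le> card V - transversal_number V F"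
        using transversal_number_le[OF V W'(1)] by linarith
      then show "ereal (real n) \<le> ereal (real (card V - transversal_number V F))" by simp
    qed
  qed
  then show ?thesis using card(2) by (simp add: of_nat_diff)
qed

section \<open>Primary decompositions of finite intersections of primes\<close>

text \<open>
  The element is a product of elements of the given ideals outside \<open>P\<close>. Here \<open>P\<close> is a set with
  multiplicatively closed complement, such as a prime or the radical of a primary ideal.
\<close>
lemma prime_avoidance_of_product:
  assumes R: "cring R" and fin: "finite \<A>" and ideals: "\<And>A. A \<in> \<A> \<Longrightarrow> ideal A R"
    and one: "\<one>\<^bsub>R\<^esub> \<notin> P"
    and prime: "\<And>a b. a \<in> carrier R \<Longrightarrow> b \<in> carrier R \<Longrightarrow> a \<otimes>\<^bsub>R\<^esub> b \<in> P \<Longrightarrow> a \<in> P \<or> b \<in> P"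
    and notsub: "\<And>A. A \<in> \<A> \<Longrightarrow> \<not> A \<subseteq> P"
  shows "\<exists>a\<in>carrier R. a \<in> \<Inter>\<A> \<and> a \<notin> P"
  using fin ideals notsub
proof (induction \<A> rule: finite_induct)
  interpret cring R by fact
  case empty
  then show ?case using one one_closed by auto
next
  interpret cring R by fact
  case (insert A \<A>)
  then obtain a where a: "a \<in> carrier R" "a \<in> \<Inter>\<A>" "a \<notin> P" by auto
  obtain b where b: "b \<in> A" "b \<notin> P" using insert.prems by blast
  have A: "ideal A R" using insert.prems by blast
  then have bc: "b \<in> carrier R" using b(1) by (meson additive_subgroup.a_Hcarr ideal.axioms(1))
  have "b \<otimes>\<^bsub>R\<^esub> a \<in> A" using ideal.I_r_closed[OF A b(1) a(1)] .
  moreover have "b \<otimes>\<^bsub>R\<^esub> a \<in> B" if "B \<in> \<A>" for B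
    using ideal.I_l_closed[of B R a b] insert.prems(1)[of B] that a(2) bc by blast
  moreover have "b \<otimes>\<^bsub>R\<^esub> a \<notin> P" using prime[OF bc a(1)] a(3) b(2) by blast
  ultimately show ?case using bc a(1) by (intro bexI[of _ "b \<otimes>\<^bsub>R\<^esub> a"]) auto
qed

lemma prime_pow_mem:
  assumes "primeideal P R" "a \<in> carrier R" "a [^]\<^bsub>R\<^esub> (n::nat) \<in> P"
  shows "a \<in> P"
  using assms(3)
proof (induction n)
  interpret primeideal P R by fact
  case 0
  then show ?case using I_notcarr one_imp_carrier by auto
next
  interpret primeideal P R by fact
  case (Suc n)
  then show ?case using I_prime[of "a [^]\<^bsub>R\<^esub> n" a] assms(2) by auto
qed

lemma ideal_radical_prime:
  assumes "primeideal P R"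
  shows "ideal_radical R P = P"
proof -
  interpret primeideal P R by fact
  have "a [^]\<^bsub>R\<^esub> (1::nat) \<in> P" if "a \<in> P" for a using that a_Hcarr by simp
  then show ?thesis
    using prime_pow_mem[OF assms] a_Hcarr unfolding ideal_radical_def by blast
qed

lemma primary_ideal_prime:
  assumes "primeideal P R"
  shows "primary_ideal R P"
proof -
  interpret primeideal P R by fact
  have "b \<in> P \<Longrightarrow> b [^]\<^bsub>R\<^esub> (1::nat) \<in> P" if "b \<in> carrier R" for b using that by simp
  then show ?thesis
    unfolding primary_ideal_def using is_ideal I_notcarr I_prime by metis
qed

lemma ideal_radical_primary:
  assumes R: "cring R" and Q: "primary_ideal R Q"
  shows "\<one>\<^bsub>R\<^esub> \<notin> ideal_radical R Q"
    and "\<And>a b. a \<in> carrier R \<Longrightarrow> b \<in> carrier R \<Longrightarrow> a \<otimes>\<^bsub>R\<^esub> b \<in> ideal_radical R Q \<Longrightarrow>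
      a \<in> ideal_radical R Q \<or> b \<in> ideal_radical R Q"
proof -
  interpret cring R by fact
  have Q': "ideal Q R" "Q \<noteq> carrier R"
    "\<And>a b. a \<in> carrier R \<Longrightarrow> b \<in> carrier R \<Longrightarrow> a \<otimes>\<^bsub>R\<^esub> b \<in> Q \<Longrightarrow> a \<in> Q \<or> (\<exists>n::nat. b [^]\<^bsub>R\<^esub> n \<in> Q)"
    using Q unfolding primary_ideal_def by blast+
  show "\<one>\<^bsub>R\<^esub> \<notin> ideal_radical R Q"
    using Q'(2) ideal.one_imp_carrier[OF Q'(1)] by (auto simp: ideal_radical_def)
  fix a b assume ab: "a \<in> carrier R" "b \<in> carrier R" "a \<otimes>\<^bsub>R\<^esub> b \<in> ideal_radical R Q"
  then obtain n :: nat where "(a \<otimes>\<^bsub>R\<^esub> b) [^]\<^bsub>R\<^esub> n \<in> Q" by (auto simp: ideal_radical_def)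
  then have "a [^]\<^bsub>R\<^esub> n \<otimes>\<^bsub>R\<^esub> b [^]\<^bsub>R\<^esub> n \<in> Q"
    using nat_pow_distrib[OF ab(1,2)] by simp
  then consider "a [^]\<^bsub>R\<^esub> n \<in> Q" | k :: nat where "(b [^]\<^bsub>R\<^esub> n) [^]\<^bsub>R\<^esub> k \<in> Q"
    using Q'(3)[of "a [^]\<^bsub>R\<^esub> n" "b [^]\<^bsub>R\<^esub> n"] ab(1,2) by auto
  then show "a \<in> ideal_radical R Q \<or> b \<in> ideal_radical R Q"
    using ab(1,2) nat_pow_pow[OF ab(2)] by cases (auto simp: ideal_radical_def)
qed

text \<open>
  Let \<open>f\<close> lie in all components but \<open>Q j\<close>. The colon ideal of \<open>I\<close> by \<open>f\<close> is the intersection of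
  the primes of the family that avoid \<open>f\<close>, and its radical is the radical of \<open>Q j\<close>. A radical of a
  primary ideal which contains such a finite intersection contains one of the primes \<open>P\<close>, hence it
  equals \<open>P\<close>. As \<open>P\<close> contains no other prime of the family, some \<open>a\<close> outside
  \<open>P\<close> lies in all the others. Then \<open>x \<otimes> a \<in> I\<close> for every \<open>x \<in> P\<close>, and since no power of \<open>a\<close>
  lies in the primary ideal \<open>Q j\<close>, it contains \<open>x\<close>.
\<close>
lemma minimal_primary_decomposition_of_primes:
  assumes R: "cring R" and fin: "finite \<P>" and primes: "\<And>P. P \<in> \<P> \<Longrightarrow> primeideal P R"
    and incomparable: "\<And>P P'. P \<in> \<P> \<Longrightarrow> P' \<in> \<P> \<Longrightarrow> P' \<subseteq> P \<Longrightarrow> P' = P"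
    and I: "I = carrier R \<inter> \<Inter>\<P>"
    and mpd: "minimal_primary_decomposition R I J Q" and j: "j \<in> J"
  shows "Q j \<in> \<P>"
proof -
  interpret cring R by fact
  have primary: "primary_ideal R (Q j)" and IQ: "I = carrier R \<inter> (\<Inter>j\<in>J. Q j)"
    and irr: "I \<noteq> carrier R \<inter> (\<Inter>k\<in>J - {j}. Q k)"
    using mpd j unfolding minimal_primary_decomposition_def by blast+
  interpret Qj: ideal "Q j" R using primary by (simp add: primary_ideal_def)
  have Qj: "a \<in> Q j \<or> (\<exists>n::nat. b [^]\<^bsub>R\<^esub> n \<in> Q j)"
    if "a \<in> carrier R" "b \<in> carrier R" "a \<otimes>\<^bsub>R\<^esub> b \<in> Q j" for a b
    using primary that unfolding primary_ideal_def by blast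
  have ideals: "ideal P R" if "P \<in> \<P>" for P
    using primes[OF that] by (rule primeideal.axioms(1))
  let ?rad = "ideal_radical R (Q j)"
  obtain f where f: "f \<in> carrier R" "f \<notin> I" "\<And>k. k \<in> J - {j} \<Longrightarrow> f \<in> Q k"
    using irr IQ by blast
  have fQ: "f \<notin> Q j" using f IQ by blast
  have fmult: "f \<otimes>\<^bsub>R\<^esub> a \<in> I" if a: "a \<in> Q j" for a
  proof -
    have ac: "a \<in> carrier R" using a by (rule Qj.a_Hcarr)
    have "f \<otimes>\<^bsub>R\<^esub> a \<in> Q k" if "k \<in> J" for k
    proof (cases "k = j")
      case True
      then show ?thesis using Qj.I_l_closed[OF a f(1)] by simp
    next
      case False
      have "ideal (Q k) R"
        using mpd that unfolding minimal_primary_decomposition_def primary_ideal_def by blast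
      then show ?thesis using f(3)[of k] False that ac by (intro ideal.I_r_closed) auto
    qed
    then show ?thesis using IQ f(1) ac by auto
  qed
  define \<F> where "\<F> = {P\<in>\<P>. f \<notin> P}"
  have rad_sub: "?rad \<subseteq> P" if P: "P \<in> \<F>" for P
  proof
    fix a assume "a \<in> ?rad"
    then obtain n :: nat where a: "a \<in> carrier R" "a [^]\<^bsub>R\<^esub> n \<in> Q j" by (auto simp: ideal_radical_def)
    interpret P: primeideal P R using primes P by (simp add: \<F>_def)
    have "f \<otimes>\<^bsub>R\<^esub> a [^]\<^bsub>R\<^esub> n \<in> P" using fmult[OF a(2)] P I by (auto simp: \<F>_def)
    then have "a [^]\<^bsub>R\<^esub> n \<in> P" using P.I_prime[OF f(1)] a(1) P by (auto simp: \<F>_def)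
    then show "a \<in> P" by (rule prime_pow_mem[OF P.primeideal a(1)])
  qed
  have "\<exists>P\<in>\<F>. P \<subseteq> ?rad"
  proof (rule ccontr)
    assume "\<not> ?thesis"
    then obtain a where a: "a \<in> carrier R" "a \<in> \<Inter>\<F>" "a \<notin> ?rad"
      using prime_avoidance_of_product[OF R _ _ ideal_radical_primary[OF R primary], of \<F>]
        fin ideals unfolding \<F>_def by fastforce
    have "f \<otimes>\<^bsub>R\<^esub> a \<in> P" if P: "P \<in> \<P>" for P
    proof (cases "f \<in> P")
      case True
      then show ?thesis by (rule ideal.I_r_closed[OF ideals[OF P] _ a(1)])
    next
      case False
      then have "a \<in> P" using a(2) P by (simp add: \<F>_def)
      then show ?thesis by (rule ideal.I_l_closed[OF ideals[OF P] _ f(1)])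
    qed
    then have "f \<otimes>\<^bsub>R\<^esub> a \<in> Q j" using I IQ f(1) a(1) j by auto
    then show False using Qj[OF f(1) a(1)] fQ a(1,3) by (auto simp: ideal_radical_def)
  qed
  then obtain P where PF: "P \<in> \<F>" "P \<subseteq> ?rad" by blast
  then have P: "P \<in> \<P>" "f \<notin> P" "P \<subseteq> ?rad" "?rad \<subseteq> P"
    using rad_sub[OF PF(1)] by (simp_all add: \<F>_def)
  interpret P: primeideal P R by (rule primes[OF P(1)])
  have "\<exists>a\<in>carrier R. a \<in> \<Inter>(\<P> - {P}) \<and> a \<notin> P"
  proof (rule prime_avoidance_of_product[OF R])
    show "\<one>\<^bsub>R\<^esub> \<notin> P" using P.I_notcarr P.one_imp_carrier by auto
  qed (use fin ideals P.I_prime incomparable[OF P(1)] in auto)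
  then obtain a where a: "a \<in> carrier R" "a \<in> \<Inter>(\<P> - {P})" "a \<notin> P" by blast
  have "Q j = P"
  proof
    show "Q j \<subseteq> P"
    proof
      fix x assume x: "x \<in> Q j"
      then have "x \<in> carrier R" "x [^]\<^bsub>R\<^esub> (1::nat) \<in> Q j" using Qj.a_Hcarr by simp_all
      then have "x \<in> ?rad" unfolding ideal_radical_def by blast
      then show "x \<in> P" using P(4) by blast
    qed
    show "P \<subseteq> Q j"
    proof
      fix x assume x: "x \<in> P"
      have xc: "x \<in> carrier R" using x by (rule P.a_Hcarr)
      have "x \<otimes>\<^bsub>R\<^esub> a \<in> P'" if P': "P' \<in> \<P>" for P'
      proof (cases "P' = P")
        case True
        then show ?thesis using P.I_r_closed[OF x a(1)] by simp
      next
        case False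
        then show ?thesis using ideal.I_l_closed[OF ideals[OF P'] _ xc] a(2) P' by auto
      qed
      then have "x \<otimes>\<^bsub>R\<^esub> a \<in> Q j" using I IQ xc a(1) j by auto
      then show "x \<in> Q j" using Qj[OF xc a(1)] P(4) a(1,3) by (auto simp: ideal_radical_def)
    qed
  qed
  then show ?thesis using P(1) by simp
qed

lemma minimal_primary_decomposition_cong:
  assumes "\<And>j. j \<in> J \<Longrightarrow> Q j = Q' j"
  shows "minimal_primary_decomposition R I J Q \<longleftrightarrow> minimal_primary_decomposition R I J Q'"
proof -
  have "(\<Inter>j\<in>J. Q j) = (\<Inter>j\<in>J. Q' j)" using assms by auto
  moreover have "(\<Inter>k\<in>J - {j}. Q k) = (\<Inter>k\<in>J - {j}. Q' k)" for j using assms by auto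
  moreover have "inj_on (\<lambda>j. ideal_radical R (Q j)) J \<longleftrightarrow> inj_on (\<lambda>j. ideal_radical R (Q' j)) J"
    using assms by (intro inj_on_cong) simp
  moreover have "(\<forall>j\<in>J. primary_ideal R (Q j)) \<longleftrightarrow> (\<forall>j\<in>J. primary_ideal R (Q' j))"
    using assms by simp
  ultimately show ?thesis unfolding minimal_primary_decomposition_def by simp
qed

definition minimal_transversals :: "'x set \<Rightarrow> 'x set set \<Rightarrow> 'x set set" where
  "minimal_transversals V F = {W \<in> transversals V F. \<forall>W'\<in>transversals V F. W' \<subseteq> W \<longrightarrow> W' = W}"

text \<open>
  If no member of \<open>F\<close> is contained in the support of a monomial, then the variables outside this
  support form a transversal.
\<close>
lemma monomial_ideal_eq_Inter:
  assumes V: "finite V" and F: "\<And>f. f \<in> F \<Longrightarrow> f \<subseteq> V"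
  shows "(monomial_ideal V F :: (('x \<Rightarrow>\<^sub>0 nat) \<Rightarrow>\<^sub>0 'k::field) set) =
    carrier (mpoly_ring V) \<inter> \<Inter>(var_ideal V ` minimal_transversals V F)" (is "?I = ?J")
proof
  show "?I \<subseteq> ?J"
    using monomial_ideal_subset_var_ideal[where ?'a = 'x and ?'b = 'k]
    by (fastforce simp: minimal_transversals_def monomial_ideal_def)
  show "?J \<subseteq> ?I"
  proof
    fix p :: "('x \<Rightarrow>\<^sub>0 nat) \<Rightarrow>\<^sub>0 'k" assume p: "p \<in> ?J"
    have "\<exists>f\<in>F. f \<subseteq> Poly_Mapping.keys m" if m: "m \<in> Poly_Mapping.keys p" for m
    proof (rule ccontr)
      assume "\<not> ?thesis"
      then have "V - Poly_Mapping.keys m \<in> transversals V F"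
        using F by (fastforce simp: transversals_def)
      then obtain W where W: "W \<in> transversals V F" "W \<subseteq> V - Poly_Mapping.keys m"
        "\<And>W'. W' \<in> transversals V F \<Longrightarrow> W' \<subseteq> W \<Longrightarrow> W' = W"
        using finite_has_minimal2[OF finite_transversals[OF V]] by metis
      then have "p \<in> var_ideal V W" using p by (auto simp: minimal_transversals_def)
      then show False using W(2) m unfolding var_ideal_def by blast
    qed
    then show "p \<in> ?I" using p by (auto simp: monomial_ideal_def)
  qed
qed

lemma minimal_primary_decomposition_monomial_ideal:
  assumes V: "finite V" and F: "\<And>f. f \<in> F \<Longrightarrow> f \<subseteq> V"
    and mpd: "minimal_primary_decomposition (mpoly_ring V)
      (monomial_ideal V F :: (('x \<Rightarrow>\<^sub>0 nat) \<Rightarrow>\<^sub>0 'k::field) set) J Q"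
  obtains W where "\<And>j. j \<in> J \<Longrightarrow> W j \<in> minimal_transversals V F \<and> Q j = var_ideal V (W j)" "inj_on W J"
proof -
  have sub: "W \<subseteq> V" if "W \<in> minimal_transversals V F" for W
    using that by (simp add: minimal_transversals_def transversals_def)
  have "Q j \<in> var_ideal V ` minimal_transversals V F" if "j \<in> J" for j
  proof (rule minimal_primary_decomposition_of_primes[OF mpoly_ring_cring _ _ _ monomial_ideal_eq_Inter[OF V F] mpd that])
    show "finite ((var_ideal V :: _ \<Rightarrow> (('x \<Rightarrow>\<^sub>0 nat) \<Rightarrow>\<^sub>0 'k) set) ` minimal_transversals V F)"
      using finite_transversals[OF V] by (simp add: minimal_transversals_def)
    fix P P' :: "(('x \<Rightarrow>\<^sub>0 nat) \<Rightarrow>\<^sub>0 'k) set"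
    assume P: "P \<in> var_ideal V ` minimal_transversals V F"
    then show "primeideal P (mpoly_ring V)" using var_ideal_prime by blast
    assume P': "P' \<in> var_ideal V ` minimal_transversals V F" "P' \<subseteq> P"
    obtain W W' where W: "P = var_ideal V W" "W \<in> minimal_transversals V F"
      "P' = var_ideal V W'" "W' \<in> minimal_transversals V F" using P P'(1) by blast
    then have "W' \<subseteq> W" using P'(2) by (simp add: var_ideal_subset_iff sub)
    then have "W' = W" using W(2,4) by (simp add: minimal_transversals_def)
    then show "P' = P" using W by simp
  qed
  then have "\<forall>j\<in>J. \<exists>W. W \<in> minimal_transversals V F \<and> Q j = var_ideal V W" by blast
  then obtain W where W: "\<forall>j\<in>J. W j \<in> minimal_transversals V F \<and> Q j = var_ideal V (W j)"
    by (rule bchoice[THEN exE])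
  moreover have "inj_on W J"
  proof (rule inj_onI)
    fix i j assume ij: "i \<in> J" "j \<in> J" "W i = W j"
    then have "Q i = Q j" using W by simp
    moreover have "inj_on (\<lambda>j. ideal_radical (mpoly_ring V) (Q j)) J"
      using mpd by (simp add: minimal_primary_decomposition_def)
    ultimately show "i = j" using ij(1,2) by (simp add: inj_on_def)
  qed
  ultimately show thesis using that by blast
qed

text \<open>
  Both sides say that the product of the variables in \<open>B \<inter> V\<close> belongs to the ideal. The
  equivalence does not mention \<open>V\<close>, so it carries the decomposition over to a larger ring.
\<close>
lemma minimal_primary_decomposition_transversals_iff:
  assumes V: "finite V"
    and W: "\<And>j. j \<in> J \<Longrightarrow> W j \<subseteq> V"
    and eq: "(monomial_ideal V F :: (('x \<Rightarrow>\<^sub>0 nat) \<Rightarrow>\<^sub>0 'k::field) set) =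
      carrier (mpoly_ring V) \<inter> (\<Inter>j\<in>J. var_ideal V (W j))"
    and F: "\<And>f. f \<in> F \<Longrightarrow> f \<subseteq> V"
  shows "(\<exists>f\<in>F. f \<subseteq> B) \<longleftrightarrow> (\<forall>j\<in>J. B \<inter> W j \<noteq> {})"
proof -
  let ?p = "(\<Prod>x\<in>B \<inter> V. mpoly_var x) :: ('x \<Rightarrow>\<^sub>0 nat) \<Rightarrow>\<^sub>0 'k"
  have B: "finite (B \<inter> V)" "B \<inter> V \<subseteq> V" using V by auto
  have "(\<exists>f\<in>F. f \<subseteq> B) \<longleftrightarrow> (\<exists>f\<in>F. f \<subseteq> B \<inter> V)" using F by blast
  also have "\<dots> \<longleftrightarrow> ?p \<in> monomial_ideal V F" by (rule prod_var_in_monomial_ideal[OF B, symmetric])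
  also have "\<dots> \<longleftrightarrow> (\<forall>j\<in>J. ?p \<in> var_ideal V (W j))"
    unfolding eq using prod_var_in_carrier[OF B, where ?'b = 'k] by auto
  also have "\<dots> \<longleftrightarrow> (\<forall>j\<in>J. B \<inter> V \<inter> W j \<noteq> {})" by (simp only: prod_var_in_var_ideal[OF B])
  also have "\<dots> \<longleftrightarrow> (\<forall>j\<in>J. B \<inter> W j \<noteq> {})" using W by blast
  finally show ?thesis .
qed

text \<open>
  Pairwise incomparable variable primes are irredundant: the product of the variables outside
  \<open>W j\<close> lies in all of them except the prime generated by \<open>W j\<close>.
\<close>
lemma minimal_primary_decomposition_var_ideals:
  assumes V: "finite V" and J: "finite J" and W: "\<And>j. j \<in> J \<Longrightarrow> W j \<subseteq> V"
    and incomparable: "\<And>j k. j \<in> J \<Longrightarrow> k \<in> J \<Longrightarrow> W k \<subseteq> W j \<Longrightarrow> k = j"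
    and F: "\<And>B. B \<subseteq> V \<Longrightarrow> (\<exists>f\<in>F. f \<subseteq> B) \<longleftrightarrow> (\<forall>j\<in>J. B \<inter> W j \<noteq> {})"
  shows "minimal_primary_decomposition (mpoly_ring V)
    (monomial_ideal V F :: (('x \<Rightarrow>\<^sub>0 nat) \<Rightarrow>\<^sub>0 'k::field) set) J (\<lambda>j. var_ideal V (W j))"
  unfolding minimal_primary_decomposition_def
proof (intro conjI ballI)
  let ?I = "monomial_ideal V F :: (('x \<Rightarrow>\<^sub>0 nat) \<Rightarrow>\<^sub>0 'k) set"
  show "finite J" by fact
  show "primary_ideal (mpoly_ring V) (var_ideal V (W j) :: (('x \<Rightarrow>\<^sub>0 nat) \<Rightarrow>\<^sub>0 'k) set)" for j
    by (rule primary_ideal_prime[OF var_ideal_prime])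
  show I: "?I = carrier (mpoly_ring V) \<inter> (\<Inter>j\<in>J. var_ideal V (W j))"
    unfolding set_eq_iff
  proof
    fix p :: "('x \<Rightarrow>\<^sub>0 nat) \<Rightarrow>\<^sub>0 'k"
    have "(\<forall>m\<in>Poly_Mapping.keys p. \<exists>f\<in>F. f \<subseteq> Poly_Mapping.keys m) \<longleftrightarrow>
        (\<forall>m\<in>Poly_Mapping.keys p. \<forall>j\<in>J. Poly_Mapping.keys m \<inter> W j \<noteq> {})"
      if "p \<in> carrier (mpoly_ring V)"
    proof (rule ball_cong[OF refl])
      fix m assume "m \<in> Poly_Mapping.keys p"
      then have "Poly_Mapping.keys m \<subseteq> V" using that unfolding mpoly_carrier_iff by blast
      then show "(\<exists>f\<in>F. f \<subseteq> Poly_Mapping.keys m) \<longleftrightarrow> (\<forall>j\<in>J. Poly_Mapping.keys m \<inter> W j \<noteq> {})"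
        by (rule F)
    qed
    then show "p \<in> ?I \<longleftrightarrow> p \<in> carrier (mpoly_ring V) \<inter> (\<Inter>j\<in>J. var_ideal V (W j))"
      unfolding monomial_ideal_def var_ideal_def by blast
  qed
  show "?I \<noteq> carrier (mpoly_ring V) \<inter> (\<Inter>k\<in>J - {j}. var_ideal V (W k))" if j: "j \<in> J" for j
  proof -
    let ?p = "(\<Prod>x\<in>V - W j. mpoly_var x) :: ('x \<Rightarrow>\<^sub>0 nat) \<Rightarrow>\<^sub>0 'k"
    have B: "finite (V - W j)" "V - W j \<subseteq> V" using V by auto
    have "(V - W j) \<inter> W k \<noteq> {}" if "k \<in> J - {j}" for k
      using incomparable[OF j, of k] W[of k] that by blast
    then have "?p \<in> carrier (mpoly_ring V) \<inter> (\<Inter>k\<in>J - {j}. var_ideal V (W k))"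
      by (simp add: prod_var_in_var_ideal[OF B] prod_var_in_carrier[OF B])
    moreover have "?p \<notin> var_ideal V (W j)" unfolding prod_var_in_var_ideal[OF B] by blast
    ultimately show ?thesis using j unfolding I by blast
  qed
  show "inj_on (\<lambda>j. ideal_radical (mpoly_ring V) (var_ideal V (W j) :: (('x \<Rightarrow>\<^sub>0 nat) \<Rightarrow>\<^sub>0 'k) set)) J"
    unfolding ideal_radical_prime[OF var_ideal_prime]
    using incomparable by (auto intro!: inj_onI simp: var_ideal_eq_iff W)
qed

section \<open>Cuts of a union of graphs\<close>

definition cut_vars :: "'v graph \<Rightarrow> 'v set cut_var set" where
  "cut_vars G = VarS ` edges G \<union> VarT ` edges G"

definition cut_support :: "'v graph \<Rightarrow> 'v set \<Rightarrow> 'v set cut_var set" where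
  "cut_support G A = (\<lambda>e. if card (e \<inter> A) = 1 then VarS e else VarT e) ` edges G"

definition cut_family :: "'v graph \<Rightarrow> 'v set cut_var set set" where
  "cut_family G = cut_support G ` Pow (verts G)"

lemma finite_edges: "finite_simple_graph G \<Longrightarrow> finite (edges G)"
  unfolding finite_simple_graph_def by (rule finite_subset[of _ "Pow (verts G)"]) auto

lemma finite_cut_vars: "finite (edges G) \<Longrightarrow> finite (cut_vars G)"
  by (simp add: cut_vars_def)

lemma card_cut_vars:
  assumes "finite (edges G)"
  shows "card (cut_vars G) = 2 * card (edges G)"
proof -
  have "card (cut_vars G) = card (VarS ` edges G) + card (VarT ` edges G)"
    unfolding cut_vars_def using assms by (intro card_Un_disjoint) auto
  then show ?thesis by (simp add: card_image inj_on_def)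
qed

lemma cut_family_subset: "f \<in> cut_family G \<Longrightarrow> f \<subseteq> cut_vars G"
  by (auto simp: cut_family_def cut_support_def cut_vars_def)

lemma cut_family_nonempty: "cut_family G \<noteq> {}"
  by (auto simp: cut_family_def)

lemma transversals_cut_family_nonempty:
  assumes "edges G \<noteq> {}" "cut_vars G \<subseteq> V"
  shows "transversals V (cut_family G) \<noteq> {}"
proof -
  have "f \<noteq> {} \<and> f \<subseteq> V" if "f \<in> cut_family G" for f
    using that cut_family_subset[OF that] assms by (auto simp: cut_family_def cut_support_def)
  then have "V \<in> transversals V (cut_family G)" by (auto simp: transversals_def)
  then show ?thesis by blast
qed

lemma cut_ring_eq: "cut_ring G = mpoly_ring (cut_vars G)"
  by (simp add: cut_ring_def cut_vars_def)

lemma cut_ideal_eq_monomial_ideal: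
  assumes "finite (edges G)"
  shows "cut_ideal G = (monomial_ideal (cut_vars G) (cut_family G) :: (_ \<Rightarrow>\<^sub>0 'k::field) set)"
proof -
  have "cut_monomial G A = (\<Prod>x\<in>cut_support G A. mpoly_var x :: _ \<Rightarrow>\<^sub>0 'k)" for A
    unfolding cut_monomial_def cut_support_def
    by (subst prod.reindex) (auto simp: inj_on_def split: if_splits)
  then have "{cut_monomial G A | A. A \<subseteq> verts G} =
      (\<lambda>f. \<Prod>x\<in>f. mpoly_var x :: _ \<Rightarrow>\<^sub>0 'k) ` cut_family G"
    by (auto simp: cut_family_def)
  moreover have "finite f \<and> f \<subseteq> cut_vars G" if "f \<in> cut_family G" for f
    using cut_family_subset[OF that] finite_subset[OF _ finite_cut_vars[OF assms]] by blast
  ultimately show ?thesis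
    unfolding cut_ideal_def cut_ring_eq by (simp add: genideal_prod_var)
qed

lemma card_edge_complement:
  assumes "card e = 2" "e \<subseteq> V"
  shows "card (e \<inter> (V - A)) = 1 \<longleftrightarrow> card (e \<inter> A) = 1"
proof -
  have "finite e" using assms(1) by (metis card.infinite zero_neq_numeral)
  moreover have "e = (e \<inter> A) \<union> (e \<inter> (V - A))" using assms(2) by blast
  ultimately have "card e = card (e \<inter> A) + card (e \<inter> (V - A))"
    by (metis (no_types, lifting) Diff_disjoint Int_assoc Int_commute Int_empty_right card_Un_disjoint finite_Int)
  then show ?thesis using assms(1) by linarith
qed

text \<open>
  A set of vertices and its complement cut the same edges. Two graphs meet in at most one vertex,
  so after complementing if necessary, the side chosen for the new graph agrees with the sides
  already chosen.
\<close>
lemma glue_cuts: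
  fixes r :: nat and G :: "nat \<Rightarrow> 'v graph"
  assumes "\<forall>i\<in>{1..r}. finite_simple_graph (G i)"
    and "\<forall>i\<in>{2..r}. card ((\<Union>j\<in>{1..<i}. verts (G j)) \<inter> verts (G i)) \<le> 1"
    and "\<forall>i\<in>{1..r}. A i \<subseteq> verts (G i)"
  shows "\<exists>C \<subseteq> (\<Union>i\<in>{1..r}. verts (G i)). \<forall>i\<in>{1..r}. \<forall>e\<in>edges (G i).
    card (e \<inter> C) = 1 \<longleftrightarrow> card (e \<inter> A i) = 1"
  using assms
proof (induction r)
  case 0
  then show ?case by auto
next
  case (Suc r)
  define U where "U = (\<Union>j\<in>{1..r}. verts (G j))"
  define V where "V = verts (G (Suc r))"
  have U: "U = (\<Union>j\<in>{1..<Suc r}. verts (G j))"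
    by (simp only: U_def atLeastLessThanSuc_atLeastAtMost)
  obtain C where C: "C \<subseteq> U" and Ccut: "\<forall>i\<in>{1..r}. \<forall>e\<in>edges (G i).
    card (e \<inter> C) = 1 \<longleftrightarrow> card (e \<inter> A i) = 1"
    using Suc.IH Suc.prems unfolding U_def by auto
  have gr: "e \<subseteq> verts (G i) \<and> card e = 2" if "i \<in> {1..Suc r}" "e \<in> edges (G i)" for i e
    using Suc.prems(1) that unfolding finite_simple_graph_def by blast
  have fin: "finite (U \<inter> V)" using Suc.prems(1) by (auto simp: V_def finite_simple_graph_def)
  have "card (U \<inter> V) \<le> 1"
  proof (cases "r = 0")
    case False
    then show ?thesis using Suc.prems(2) unfolding U V_def by simp
  qed (simp add: U_def)
  then have meet: "x = y" if "x \<in> U \<inter> V" "y \<in> U \<inter> V" for x y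
    using that card_le_Suc0_iff_eq[OF fin] by simp
  \<comment> \<open>The common part is empty or a single vertex, so if the sides disagree there, the complement
      agrees.\<close>
  define D where "D = (if U \<inter> V \<inter> C = U \<inter> V \<inter> A (Suc r) then A (Suc r) else V - A (Suc r))"
  have D: "D \<subseteq> V" using Suc.prems(3) by (auto simp: D_def V_def)
  have agree: "U \<inter> V \<inter> C = U \<inter> V \<inter> D"
    unfolding D_def using meet by (auto split: if_splits)
  have Dcut: "card (e \<inter> D) = 1 \<longleftrightarrow> card (e \<inter> A (Suc r)) = 1" if "e \<in> edges (G (Suc r))" for e
    using card_edge_complement[of e V] gr[of "Suc r" e] that by (auto simp: D_def V_def)
  have "card (e \<inter> (C \<union> D)) = 1 \<longleftrightarrow> card (e \<inter> A i) = 1"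
    if i: "i \<in> {1..Suc r}" and e: "e \<in> edges (G i)" for i e
  proof (cases "i = Suc r")
    case True
    then have "e \<subseteq> V" using gr[OF i e] by (simp add: V_def)
    then have "e \<inter> (C \<union> D) = e \<inter> D" using agree C by blast
    then show ?thesis using Dcut e True by simp
  next
    case False
    then have i': "i \<in> {1..r}" using i by auto
    then have "e \<subseteq> U" using gr[OF i e] by (auto simp: U_def)
    then have "e \<inter> (C \<union> D) = e \<inter> C" using agree D by blast
    then show ?thesis using Ccut i' e by simp
  qed
  moreover have "C \<union> D \<subseteq> (\<Union>i\<in>{1..Suc r}. verts (G i))"
    using C D unfolding U_def V_def by fastforce
  ultimately show ?case by blast
qed

text \<open>A common edge would give two common vertices.\<close>
lemma edges_disjoint:
  fixes r :: nat and G :: "nat \<Rightarrow> 'v graph"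
  assumes graphs: "\<forall>i\<in>{1..r}. finite_simple_graph (G i)"
    and meet: "\<forall>i\<in>{2..r}. card ((\<Union>j\<in>{1..<i}. verts (G j)) \<inter> verts (G i)) \<le> 1"
    and ij: "i \<in> {1..r}" "j \<in> {1..r}" "i \<noteq> j"
  shows "edges (G i) \<inter> edges (G j) = {}"
proof -
  have less: "edges (G i) \<inter> edges (G j) = {}" if ij: "i \<in> {1..r}" "j \<in> {1..r}" "i < j" for i j
  proof (rule ccontr)
    assume "\<not> ?thesis"
    then obtain e where e: "e \<in> edges (G i)" "e \<in> edges (G j)" by blast
    then have sub: "e \<subseteq> verts (G i)" "e \<subseteq> verts (G j)" "card e = 2" "finite (verts (G j))"
      using graphs ij unfolding finite_simple_graph_def by blast+
    then have "e \<subseteq> (\<Union>j\<in>{1..<j}. verts (G j)) \<inter> verts (G j)" using ij by fastforce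
    then have "card e \<le> card ((\<Union>j\<in>{1..<j}. verts (G j)) \<inter> verts (G j))"
      using sub(4) by (intro card_mono) auto
    moreover have "card ((\<Union>j\<in>{1..<j}. verts (G j)) \<inter> verts (G j)) \<le> 1"
      using meet ij by simp
    ultimately show False using sub(3) by simp
  qed
  show ?thesis using less[of i j] less[of j i] ij by (cases "i < j") auto
qed

text \<open>
  From left to right, a cut of the union is restricted to each graph. From right to left, cuts of
  the single graphs are glued to one cut of the union.
\<close>
lemma cut_family_graph_union_iff:
  fixes r :: nat and G :: "nat \<Rightarrow> 'v graph"
  assumes graphs: "\<forall>i\<in>{1..r}. finite_simple_graph (G i)"
    and meet: "\<forall>i\<in>{2..r}. card ((\<Union>j\<in>{1..<i}. verts (G j)) \<inter> verts (G i)) \<le> 1"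
  shows "(\<exists>f\<in>cut_family (graph_union G {1..r}). f \<subseteq> B) \<longleftrightarrow>
    (\<forall>i\<in>{1..r}. \<exists>f\<in>cut_family (G i). f \<subseteq> B)"
proof
  assume "\<exists>f\<in>cut_family (graph_union G {1..r}). f \<subseteq> B"
  then obtain A where A: "cut_support (graph_union G {1..r}) A \<subseteq> B" by (auto simp: cut_family_def)
  show "\<forall>i\<in>{1..r}. \<exists>f\<in>cut_family (G i). f \<subseteq> B"
  proof
    fix i assume i: "i \<in> {1..r}"
    have "e \<inter> (A \<inter> verts (G i)) = e \<inter> A" if "e \<in> edges (G i)" for e
      using graphs i that unfolding finite_simple_graph_def by blast
    then have "cut_support (G i) (A \<inter> verts (G i)) = cut_support (G i) A"
      unfolding cut_support_def by simp
    also have "\<dots> \<subseteq> cut_support (graph_union G {1..r}) A"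
      unfolding cut_support_def by (rule image_mono) (use i in \<open>auto simp: graph_union_def\<close>)
    finally show "\<exists>f\<in>cut_family (G i). f \<subseteq> B"
      using A unfolding cut_family_def by blast
  qed
next
  assume "\<forall>i\<in>{1..r}. \<exists>f\<in>cut_family (G i). f \<subseteq> B"
  then have "\<forall>i\<in>{1..r}. \<exists>A. A \<subseteq> verts (G i) \<and> cut_support (G i) A \<subseteq> B"
    unfolding cut_family_def by blast
  then obtain A where A: "\<forall>i\<in>{1..r}. A i \<subseteq> verts (G i) \<and> cut_support (G i) (A i) \<subseteq> B"
    by (rule bchoice[THEN exE])
  then have "\<forall>i\<in>{1..r}. A i \<subseteq> verts (G i)" by blast
  from glue_cuts[OF graphs meet this] obtain C where
    C: "C \<subseteq> (\<Union>i\<in>{1..r}. verts (G i))" and cut: "\<And>i e. i \<in> {1..r} \<Longrightarrow> e \<in> edges (G i) \<Longrightarrow>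
      card (e \<inter> C) = 1 \<longleftrightarrow> card (e \<inter> A i) = 1"
    by blast
  have "cut_support (graph_union G {1..r}) C = (\<Union>i\<in>{1..r}. cut_support (G i) C)"
    by (simp only: cut_support_def graph_union_def graph.simps image_UN)
  also have "\<dots> = (\<Union>i\<in>{1..r}. cut_support (G i) (A i))"
    unfolding cut_support_def using cut by (intro SUP_cong image_cong refl) simp
  also have "\<dots> \<subseteq> B" using A by blast
  finally show "\<exists>f\<in>cut_family (graph_union G {1..r}). f \<subseteq> B"
    using C unfolding cut_family_def by (force simp: graph_union_def)
qed

text \<open>
  A set fails to be a transversal iff its complement contains a member of the family, so this is
  the previous lemma for the complement.
\<close>
lemma transversals_graph_union:
  fixes r :: nat and G :: "nat \<Rightarrow> 'v graph"
  assumes "\<forall>i\<in>{1..r}. finite_simple_graph (G i)"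
    and "\<forall>i\<in>{2..r}. card ((\<Union>j\<in>{1..<i}. verts (G j)) \<inter> verts (G i)) \<le> 1"
  shows "transversals V (cut_family (graph_union G {1..r})) = (\<Union>i\<in>{1..r}. transversals V (cut_family (G i)))"
proof -
  have iff: "W \<in> transversals V F \<longleftrightarrow> W \<subseteq> V \<and> \<not> (\<exists>f\<in>F. f \<subseteq> - W)"
    for F and W :: "'v set cut_var set"
    unfolding transversals_def by blast
  show ?thesis
    unfolding set_eq_iff UN_iff iff cut_family_graph_union_iff[OF assms] by blast
qed

section \<open>The monomial cut ideal of the union\<close>

theorem corollary2p4:
  fixes r :: nat
    and G :: "nat \<Rightarrow> 'v graph"
    and H :: "'v graph"
    and S :: "(('v set cut_var \<Rightarrow>\<^sub>0 nat) \<Rightarrow>\<^sub>0 'k::field) ring"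
  assumes "r \<ge> 1"
    and "\<forall>i\<in>{1..r}. finite_simple_graph (G i) \<and> edges (G i) \<noteq> {}"
    and "\<forall>i\<in>{2..r}. card ((\<Union>j\<in>{1..<i}. verts (G j)) \<inter> verts (G i)) \<le> 1"
    and "H = graph_union G {1..r}"
    and "S = cut_ring H"
  shows
    "(\<forall>(n :: nat \<Rightarrow> nat) (P :: nat \<Rightarrow> nat \<Rightarrow> (('v set cut_var \<Rightarrow>\<^sub>0 nat) \<Rightarrow>\<^sub>0 'k) set).
        (\<forall>i\<in>{1..r}.
           minimal_primary_decomposition (cut_ring (G i)) (cut_ideal (G i)) {1..n i} (P i)) \<longrightarrow>
        minimal_primary_decomposition S (cut_ideal H)
          (SIGMA i:{1..r}. {1..n i}) (\<lambda>(i, j). Idl\<^bsub>S\<^esub> (P i j))) \<and>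
     krull_dim (S Quot cut_ideal H) =
       ereal (real (2 * card (edges H))) -
         (MIN i\<in>{1..r}. ideal_height S (Idl\<^bsub>S\<^esub> (cut_ideal (G i))))"
proof -
  have graphs: "\<forall>i\<in>{1..r}. finite_simple_graph (G i)" using assms(2) by blast
  have ne: "edges (G i) \<noteq> {}" if "i \<in> {1..r}" for i using assms(2) that by blast
  note meet = assms(3)
  have fin: "finite (edges (G i))" if "i \<in> {1..r}" for i using graphs that finite_edges by blast
  define V where "V = cut_vars H"
  define F where "F = cut_family H"
  have edgesH: "edges H = (\<Union>i\<in>{1..r}. edges (G i))" by (simp add: assms(4) graph_union_def)
  have finH: "finite (edges H)" using fin by (simp add: edgesH)
  have V: "finite V" unfolding V_def by (rule finite_cut_vars[OF finH])
  have sub: "cut_vars (G i) \<subseteq> V" if "i \<in> {1..r}" for i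
    using that unfolding V_def cut_vars_def edgesH by blast
  have S: "S = mpoly_ring V" by (simp add: assms(5) V_def cut_ring_eq)
  have I: "cut_ideal H = (monomial_ideal V F :: (_ \<Rightarrow>\<^sub>0 'k) set)"
    unfolding V_def F_def by (rule cut_ideal_eq_monomial_ideal[OF finH])
  have Ii: "cut_ideal (G i) = (monomial_ideal (cut_vars (G i)) (cut_family (G i)) :: (_ \<Rightarrow>\<^sub>0 'k) set)"
    if "i \<in> {1..r}" for i
    by (rule cut_ideal_eq_monomial_ideal[OF fin[OF that]])
  have FV: "f \<subseteq> V" if "f \<in> F" for f
    using that unfolding F_def V_def by (rule cut_family_subset)
  have join: "(\<exists>f\<in>F. f \<subseteq> B) \<longleftrightarrow> (\<forall>i\<in>{1..r}. \<exists>f\<in>cut_family (G i). f \<subseteq> B)" for B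
    unfolding F_def assms(4) by (rule cut_family_graph_union_iff[OF graphs meet])
  have trans: "transversals V F = (\<Union>i\<in>{1..r}. transversals V (cut_family (G i)))"
    unfolding F_def assms(4) by (rule transversals_graph_union[OF graphs meet])
  have decomposition: "minimal_primary_decomposition S (cut_ideal H)
          (SIGMA i:{1..r}. {1..n i}) (\<lambda>(i, j). Idl\<^bsub>S\<^esub> (P i j))"
    if mpd: "\<forall>i\<in>{1..r}. minimal_primary_decomposition (cut_ring (G i)) (cut_ideal (G i)) {1..n i} (P i)"
    for n :: "nat \<Rightarrow> nat" and P :: "nat \<Rightarrow> nat \<Rightarrow> (('v set cut_var \<Rightarrow>\<^sub>0 nat) \<Rightarrow>\<^sub>0 'k) set"
  proof -
    have mpd': "minimal_primary_decomposition (mpoly_ring (cut_vars (G i)))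
        (monomial_ideal (cut_vars (G i)) (cut_family (G i))) {1..n i} (P i)" if "i \<in> {1..r}" for i
      using mpd that by (simp add: Ii cut_ring_eq)
    have "\<exists>W. (\<forall>j\<in>{1..n i}. W j \<in> minimal_transversals (cut_vars (G i)) (cut_family (G i)) \<and>
        P i j = var_ideal (cut_vars (G i)) (W j)) \<and> inj_on W {1..n i}" if i: "i \<in> {1..r}" for i
      using minimal_primary_decomposition_monomial_ideal[OF finite_cut_vars[OF fin[OF i]] cut_family_subset mpd'[OF i]]
      by metis
    then have "\<forall>i\<in>{1..r}. \<exists>W. (\<forall>j\<in>{1..n i}. W j \<in> minimal_transversals (cut_vars (G i)) (cut_family (G i)) \<and>
        P i j = var_ideal (cut_vars (G i)) (W j)) \<and> inj_on W {1..n i}" by blast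
    then obtain W where W: "\<forall>i\<in>{1..r}. (\<forall>j\<in>{1..n i}.
        W i j \<in> minimal_transversals (cut_vars (G i)) (cut_family (G i)) \<and>
        P i j = var_ideal (cut_vars (G i)) (W i j)) \<and> inj_on (W i) {1..n i}"
      by (rule bchoice[THEN exE])
    have Wmin: "W i j \<in> minimal_transversals (cut_vars (G i)) (cut_family (G i))"
      and WP: "P i j = var_ideal (cut_vars (G i)) (W i j)" if "i \<in> {1..r}" "j \<in> {1..n i}" for i j
      using W that by blast+
    have Wsub: "W i j \<subseteq> cut_vars (G i)" and Wne: "W i j \<noteq> {}" if "i \<in> {1..r}" "j \<in> {1..n i}" for i j
      using Wmin[OF that] cut_family_nonempty[of "G i"]
      by (auto simp: minimal_transversals_def transversals_def)
    have transversals: "(\<exists>f\<in>cut_family (G i). f \<subseteq> B) \<longleftrightarrow> (\<forall>j\<in>{1..n i}. B \<inter> W i j \<noteq> {})"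
      if i: "i \<in> {1..r}" for i B
    proof (rule minimal_primary_decomposition_transversals_iff[OF finite_cut_vars[OF fin[OF i]] Wsub[OF i] _ cut_family_subset])
      have "monomial_ideal (cut_vars (G i)) (cut_family (G i)) =
          carrier (mpoly_ring (cut_vars (G i))) \<inter> (\<Inter>j\<in>{1..n i}. P i j)"
        using mpd'[OF i] unfolding minimal_primary_decomposition_def by blast
      also have "(\<Inter>j\<in>{1..n i}. P i j) = (\<Inter>j\<in>{1..n i}. var_ideal (cut_vars (G i)) (W i j))"
        using WP[OF i] by simp
      finally show "(monomial_ideal (cut_vars (G i)) (cut_family (G i)) :: (_ \<Rightarrow>\<^sub>0 'k) set) =
          carrier (mpoly_ring (cut_vars (G i))) \<inter> (\<Inter>j\<in>{1..n i}. var_ideal (cut_vars (G i)) (W i j))" .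
    qed
    let ?J = "SIGMA i:{1..r}. {1..n i}"
    let ?W = "\<lambda>(i, j). W i j"
    have "minimal_primary_decomposition (mpoly_ring V) (monomial_ideal V F :: (_ \<Rightarrow>\<^sub>0 'k) set) ?J
        (\<lambda>p. var_ideal V (?W p))"
    proof (rule minimal_primary_decomposition_var_ideals[OF V])
      show "finite ?J" by simp
      show "?W p \<subseteq> V" if "p \<in> ?J" for p using that Wsub sub by fastforce
      show "(\<exists>f\<in>F. f \<subseteq> B) \<longleftrightarrow> (\<forall>p\<in>?J. B \<inter> ?W p \<noteq> {})" for B
        unfolding join using transversals by simp
      fix p q assume p: "p \<in> ?J" and q: "q \<in> ?J" and le: "?W q \<subseteq> ?W p"
      obtain i j i' j' where ij: "p = (i, j)" "i \<in> {1..r}" "j \<in> {1..n i}"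
        and ij': "q = (i', j')" "i' \<in> {1..r}" "j' \<in> {1..n i'}" using p q by auto
      have le': "W i' j' \<subseteq> W i j" using le ij ij' by simp
      have i': "i' = i"
      proof (rule ccontr)
        assume "i' \<noteq> i"
        then have "edges (G i') \<inter> edges (G i) = {}" by (rule edges_disjoint[OF graphs meet ij'(2) ij(2)])
        then have "cut_vars (G i') \<inter> cut_vars (G i) = {}" by (auto simp: cut_vars_def)
        then show False using le' Wsub[OF ij(2,3)] Wsub[OF ij'(2,3)] Wne[OF ij'(2,3)] by blast
      qed
      have "inj_on (W i) {1..n i}" using W ij(2) by blast
      moreover have "W i j' = W i j"
        using i' le' Wmin[OF ij(2,3)] Wmin[OF ij'(2,3)] by (simp add: minimal_transversals_def)
      moreover have "j' \<in> {1..n i}" using ij'(3) i' by simp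
      ultimately have "j' = j" using ij(3) by (rule inj_onD)
      then show "q = p" using i' ij(1) ij'(1) by simp
    qed
    then show ?thesis
      unfolding S I
    proof (rule minimal_primary_decomposition_cong[THEN iffD1, rotated])
      fix p assume "p \<in> ?J"
      then obtain i j where ij: "p = (i, j)" "i \<in> {1..r}" "j \<in> {1..n i}" by auto
      show "var_ideal V (?W p) = (case p of (i, j) \<Rightarrow> Idl\<^bsub>mpoly_ring V\<^esub> (P i j))"
        using genideal_var_ideal[OF Wsub[OF ij(2,3)] sub[OF ij(2)], where ?'b = 'k] WP[OF ij(2,3)] ij(1) by simp
    qed
  qed
  have height: "ideal_height S (Idl\<^bsub>S\<^esub> (cut_ideal (G i))) = ereal (real (transversal_number V (cut_family (G i))))"
    if i: "i \<in> {1..r}" for i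
  proof -
    have F: "finite f \<and> f \<subseteq> cut_vars (G i)" if "f \<in> cut_family (G i)" for f
      using cut_family_subset[OF that] finite_subset finite_cut_vars[OF fin[OF i]] by blast
    have "Idl\<^bsub>mpoly_ring V\<^esub> (cut_ideal (G i)) = (monomial_ideal V (cut_family (G i)) :: (_ \<Rightarrow>\<^sub>0 'k) set)"
      unfolding Ii[OF i] by (rule genideal_monomial_ideal[OF F sub[OF i]])
    then show ?thesis
      unfolding S using F sub[OF i] transversals_cut_family_nonempty[OF ne[OF i] sub[OF i]]
      by (subst ideal_height_monomial_ideal[OF V, symmetric]) auto
  qed
  have neF: "transversals V F \<noteq> {}"
    using transversals_cut_family_nonempty[OF ne sub, of 1] assms(1) unfolding trans by auto
  have le: "transversal_number V F \<le> transversal_number V (cut_family (G i))" if i: "i \<in> {1..r}" for i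
  proof -
    obtain W where W: "W \<in> transversals V (cut_family (G i))"
      "card W = transversal_number V (cut_family (G i))"
      using transversal_number_attained[OF V transversals_cut_family_nonempty[OF ne[OF i] sub[OF i]]] .
    have "W \<in> transversals V F" using W(1) i unfolding trans by blast
    from transversal_number_le[OF V this] show ?thesis using W(2) by simp
  qed
  have "(MIN i\<in>{1..r}. ideal_height S (Idl\<^bsub>S\<^esub> (cut_ideal (G i)))) = ereal (real (transversal_number V F))"
  proof (rule Min_eqI)
    show "finite ((\<lambda>i. ideal_height S (Idl\<^bsub>S\<^esub> (cut_ideal (G i)))) ` {1..r})" by simp
    show "ereal (real (transversal_number V F)) \<le> y"
      if mem: "y \<in> (\<lambda>i. ideal_height S (Idl\<^bsub>S\<^esub> (cut_ideal (G i)))) ` {1..r}" for y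
    proof -
      obtain i where i: "i \<in> {1..r}" and y: "y = ereal (real (transversal_number V (cut_family (G i))))"
        using mem height by auto
      show ?thesis using le[OF i] by (simp add: y)
    qed
    obtain W where W: "W \<in> transversals V F" "card W = transversal_number V F"
      using transversal_number_attained[OF V neF] .
    then obtain i where i: "i \<in> {1..r}" "W \<in> transversals V (cut_family (G i))" unfolding trans by blast
    have "transversal_number V (cut_family (G i)) = transversal_number V F"
      using transversal_number_le[OF V i(2)] W(2) le[OF i(1)] by simp
    then show "ereal (real (transversal_number V F)) \<in>
        (\<lambda>i. ideal_height S (Idl\<^bsub>S\<^esub> (cut_ideal (G i)))) ` {1..r}"
      using height[OF i(1)] i(1) by (metis image_eqI)
  qed
  moreover have "krull_dim (S Quot cut_ideal H) =
      ereal (real (card V)) - ereal (real (transversal_number V F))"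
    unfolding S I by (rule krull_dim_quot_monomial_ideal[OF V FV neF])
  moreover have "card V = 2 * card (edges H)" unfolding V_def by (rule card_cut_vars[OF finH])
  ultimately show ?thesis using decomposition by simp
qed

end
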